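(* Let $d\ge1$, $x_0,x_1\in\mathbb{R}^d$, $\eta>0$, $\rho>0$, and let $q_t^{x_0,x_1}(y,x)=\lambda_t(x)J_t(y)$ be the jump kernel density defined in the context. Let $\mu^J\in\mathbb{R}^d$ and $\Sigma^J\in\mathbb{R}^{d\times d}$ denote the mean and covariance matrix of (the probability measure with density) $J_t$. For fixed $(t,x)\in[0,1]\times\mathbb{R}^d$ and all $\lambda>0$, $\mu\in\mathbb{R}^d$, $\Sigma\in\mathrm{SPD}(d)$ it holds that $$\mathrm{KL}\big(q_t^{x_0,x_1}(\cdot,x),\,\lambda\,\mathcal N(\mu,\Sigma)\big)=F_{t,x}(\lambda,\mu,\Sigma)+\mathrm{const},$$ $$F_{t,x}(\lambda,\mu,\Sigma):=\lambda+\frac{\lambda_t(x)}{2}\Big(\log(\det\Sigma)-2\log(\lambda)+\langle\Sigma^{-1},\Sigma^J\rangle+\langle\mu^J-\mu,\Sigma^{-1}(\mu^J-\mu)\rangle\Big),$$ where $\mathrm{const}$ is a (finite) constant independent of $(\lambda,\mu,\Sigma)$. Moreover, if $\lambda_t(x)\ne0$ and $\Sigma^J$ is positive definite, then the problem $$\min_{(\lambda,\mu,\Sigma)\in\mathbb{R}_{>0}\times\mathbb{R}^d\times\mathrm{SPD}(d)}F_{t,x}(\lambda,\mu,\Sigma)$$ has the unique minimizer $(\lambda_t(x),\mu^J,\Sigma^J)$.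
   Context: $\mathrm{SPD}(d)$ is the set of symmetric positive definite $d\times d$ matrices; $\langle A,B\rangle=\mathrm{tr}(A^{\mathsf T}B)$ for matrices and the Euclidean inner product for vectors. $\mathcal N(\mu,\Sigma)$ also denotes the Gaussian density, and absolutely continuous measures are identified with their densities. Kullback-Leibler divergence of finite non-negative absolutely continuous measures with densities $p,q$ on $\mathbb{R}^d$: $\mathrm{KL}(p,q):=\int p(y)\log\big(\frac{p(y)}{q(y)}\big)-p(y)+q(y)\,\mathrm dy$ if $p(y)=0$ whenever $q(y)=0$ for a.e. $y$, and $+\infty$ otherwise (with $0\log 0=0$). Jump kernel: for $t\in[0,1]$ set $m_t:=(1-t)x_0+tx_1$, $\tau_t:=\eta^2t(1-t)+\rho^2$, let $p_t$ be the density of $\mathcal N(m_t,\tau_tI_d)$, and $$\xi_t(y):=\frac{\eta^2(1-2t)}{2\tau_t}\Big(\frac{\|y-m_t\|^2}{\tau_t}+2a_t^{\mathsf T}\frac{y-m_t}{\sqrt{\tau_t}}-d\Big),\qquad a_t:=\frac{\sqrt{\tau_t}}{\eta^2(1-2t)}(x_1-x_0),$$ where the singularity of $a_t$ at $t=1/2$ is cancelled by the prefactor, i.e. $\xi_t(y)=\frac{\eta^2(1-2t)}{2\tau_t}\big(\frac{\|y-m_t\|^2}{\tau_t}-d\big)+\frac{(x_1-x_0)^{\mathsf T}(y-m_t)}{\tau_t}$ for all $t\in[0,1]$. Then $$\lambda_t:=\max(0,-\xi_t),\qquad J_t:=\frac{\max(0,\xi_t)p_t}{\int_{\mathbb{R}^d}\max(0,\xi_t)p_t\,\mathrm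 dy},$$ except that for $t=1/2$ and $x_0=x_1$ (where $\xi_t\equiv0$) $J_{1/2}$ is set to be the density of $\mathcal N(0,I_d)$. Finally $q_t^{x_0,x_1}(y,x):=\lambda_t(x)J_t(y)$. *)

theory Defs
  imports "HOL-Analysis.Analysis"
begin

definition pos_definite :: "real^'n^'n \<Rightarrow> bool" where
  "pos_definite A \<longleftrightarrow> (\<forall>v. v \<noteq> 0 \<longrightarrow> v \<bullet> (A *v v) > 0)"

definition SPD :: "(real^'n^'n) set" where
  "SPD = {A. transpose A = A \<and> pos_definite A}"

definition gauss_density :: "real^'n \<Rightarrow> real^'n^'n \<Rightarrow> real^'n \<Rightarrow> real" where
  "gauss_density \<mu> \<Sigma> y =
     exp (- ((y - \<mu>) \<bullet> (matrix_inv \<Sigma> *v (y - \<mu>))) / 2) / sqrt ((2 * pi) ^ CARD('n) * det \<Sigma>)"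

text \<open>
  Kullback-Leibler divergence of finite, not necessarily normalised, measures given by their
  (non-negative, measurable) densities. Since \<open>a * ln (a / b) - a + b \<ge> 0\<close> for \<open>a \<ge> 0\<close> and
  \<open>b > 0\<close>, in the first case the integrand is non-negative almost everywhere. So the
  non-negative integral below is the ordinary one, with value \<open>\<infinity>\<close> when it diverges. The
  convention \<open>0 * ln 0 = 0\<close> (also for \<open>0 / 0\<close>) holds automatically.
\<close>
definition KL :: "(real^'n \<Rightarrow> real) \<Rightarrow> (real^'n \<Rightarrow> real) \<Rightarrow> ereal" where
  "KL p q =
     (if (AE y in lborel. q y = 0 \<longrightarrow> p y = 0)
      then enn2ereal (\<integral>\<^sup>+ y. ennreal (p y * ln (p y / q y) - p y + q y) \<partial>lborel)
      else \<infinity>)"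

definition mean_vector :: "(real^'n) measure \<Rightarrow> real^'n" where
  "mean_vector M = (\<integral>y. y \<partial>M)"

definition covariance_matrix :: "(real^'n) measure \<Rightarrow> real^'n^'n" where
  "covariance_matrix M =
     (\<chi> i j. \<integral>y. (y $ i - mean_vector M $ i) * (y $ j - mean_vector M $ j) \<partial>M)"

definition path_mean :: "real^'n \<Rightarrow> real^'n \<Rightarrow> real \<Rightarrow> real^'n" where
  "path_mean x0 x1 t = (1 - t) *\<^sub>R x0 + t *\<^sub>R x1"

definition path_var :: "real \<Rightarrow> real \<Rightarrow> real \<Rightarrow> real" where
  "path_var \<eta> \<rho> t = \<eta>\<^sup>2 * t * (1 - t) + \<rho>\<^sup>2"

definition path_density ::
    "real \<Rightarrow> real \<Rightarrow> real^'n \<Rightarrow> real^'n \<Rightarrow> real \<Rightarrow> real^'n \<Rightarrow> real" where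
  "path_density \<eta> \<rho> x0 x1 t =
     gauss_density (path_mean x0 x1 t) (path_var \<eta> \<rho> t *\<^sub>R mat 1)"

text \<open>
  With \<open>m\<close>, \<open>\<tau>\<close> the path mean and variance and
  \<open>a = (sqrt \<tau> / (\<eta>\<^sup>2 * (1 - 2 * t))) *\<^sub>R (x1 - x0)\<close>, the function is
  \<open>\<eta>\<^sup>2 * (1 - 2 * t) / (2 * \<tau>) * ((norm (y - m))\<^sup>2 / \<tau> + 2 * (a \<bullet> (y - m)) / sqrt \<tau> - d)\<close>.
  It is written with the prefactor multiplied into the linear term, which cancels the
  singularity of \<open>a\<close> at \<open>t = 1/2\<close>.
\<close>
definition jump_xi ::
    "real \<Rightarrow> real \<Rightarrow> real^'n \<Rightarrow> real^'n \<Rightarrow> real \<Rightarrow> real^'n \<Rightarrow> real" where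
  "jump_xi \<eta> \<rho> x0 x1 t y =
     (let m = path_mean x0 x1 t; \<tau> = path_var \<eta> \<rho> t in
       \<eta>\<^sup>2 * (1 - 2 * t) / (2 * \<tau>) * ((norm (y - m))\<^sup>2 / \<tau> - real CARD('n))
       + ((x1 - x0) \<bullet> (y - m)) / \<tau>)"

definition jump_rate ::
    "real \<Rightarrow> real \<Rightarrow> real^'n \<Rightarrow> real^'n \<Rightarrow> real \<Rightarrow> real^'n \<Rightarrow> real" where
  "jump_rate \<eta> \<rho> x0 x1 t x = max 0 (- jump_xi \<eta> \<rho> x0 x1 t x)"

definition jump_density ::
    "real \<Rightarrow> real \<Rightarrow> real^'n \<Rightarrow> real^'n \<Rightarrow> real \<Rightarrow> real^'n \<Rightarrow> real" where
  "jump_density \<eta> \<rho> x0 x1 t y =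
     (if t = 1/2 \<and> x0 = x1 then gauss_density 0 (mat 1) y
      else max 0 (jump_xi \<eta> \<rho> x0 x1 t y) * path_density \<eta> \<rho> x0 x1 t y
           / (\<integral>z. max 0 (jump_xi \<eta> \<rho> x0 x1 t z) * path_density \<eta> \<rho> x0 x1 t z \<partial>lborel))"

definition jump_kernel ::
    "real \<Rightarrow> real \<Rightarrow> real^'n \<Rightarrow> real^'n \<Rightarrow> real \<Rightarrow> real^'n \<Rightarrow> real^'n \<Rightarrow> real" where
  "jump_kernel \<eta> \<rho> x0 x1 t y x = jump_rate \<eta> \<rho> x0 x1 t x * jump_density \<eta> \<rho> x0 x1 t y"

definition jump_measure ::
    "real \<Rightarrow> real \<Rightarrow> real^'n \<Rightarrow> real^'n \<Rightarrow> real \<Rightarrow> (real^'n) measure" where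
  "jump_measure \<eta> \<rho> x0 x1 t = density lborel (\<lambda>y. ennreal (jump_density \<eta> \<rho> x0 x1 t y))"

definition jump_mean :: "real \<Rightarrow> real \<Rightarrow> real^'n \<Rightarrow> real^'n \<Rightarrow> real \<Rightarrow> real^'n" where
  "jump_mean \<eta> \<rho> x0 x1 t = mean_vector (jump_measure \<eta> \<rho> x0 x1 t)"

definition jump_cov :: "real \<Rightarrow> real \<Rightarrow> real^'n \<Rightarrow> real^'n \<Rightarrow> real \<Rightarrow> real^'n^'n" where
  "jump_cov \<eta> \<rho> x0 x1 t = covariance_matrix (jump_measure \<eta> \<rho> x0 x1 t)"

definition jump_objective ::
    "real \<Rightarrow> real \<Rightarrow> real^'n \<Rightarrow> real^'n \<Rightarrow> real \<Rightarrow> real^'n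
      \<Rightarrow> real \<Rightarrow> real^'n \<Rightarrow> real^'n^'n \<Rightarrow> real" where
  "jump_objective \<eta> \<rho> x0 x1 t x l \<mu> \<Sigma> =
     (let \<mu>J = jump_mean \<eta> \<rho> x0 x1 t; \<Sigma>J = jump_cov \<eta> \<rho> x0 x1 t in
       l + jump_rate \<eta> \<rho> x0 x1 t x / 2 *
         (ln (det \<Sigma>) - 2 * ln l
          + trace (transpose (matrix_inv \<Sigma>) ** \<Sigma>J)
          + (\<mu>J - \<mu>) \<bullet> (matrix_inv \<Sigma> *v (\<mu>J - \<mu>))))"

end

theory Submission
  imports Defs "HOL-Probability.Distributions"
begin

text \<open>
  The density of \<open>N(\<mu>, \<Sigma>)\<close> has a logarithm that is a quadratic polynomial. So for a probability
  density \<open>f\<close> with finite second moments and finite entropy, expanding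
  \<open>r f ln (r f / (l N(\<mu>, \<Sigma>)))\<close> and integrating only needs the mean and the covariance matrix of
  \<open>f\<close>: the terms that contain \<open>(l, \<mu>, \<Sigma>)\<close> add up to the objective, and \<open>r ln r - r\<close>, the
  entropy of \<open>f\<close> and \<open>n ln (2 \<pi>)\<close> go into the constant (\<open>KL_gauss\<close>).

  This computation also solves the minimisation problem. The objective depends on \<open>f\<close> only through
  its mean \<open>m\<close> and covariance \<open>S\<close>, so it may be computed with \<open>f = N(m, S)\<close> instead. Up to a constant
  the objective is therefore the divergence of \<open>l N(\<mu>, \<Sigma>)\<close> from \<open>r N(m, S)\<close>, which is non-negative
  and vanishes only if the two densities agree almost everywhere; mass, mean and covariance then
  identify the parameters (\<open>gauss_objective_minimum\<close>). Thus neither derivatives with respect to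
  matrices nor eigenvalues are needed for the minimisation.

  It remains to see that the jump density belongs to this class. Its numerator is a quadratically
  growing function times an isotropic Gaussian, so all integrals converge
  (\<open>finite_entropy_density_weighted_gauss\<close>). Its normalising integral could only vanish if \<open>\<xi>\<close> were
  nowhere positive, and that is impossible as soon as \<open>\<xi>\<close> is negative somewhere
  (\<open>jump_xi_pos_exists\<close>), that is, as soon as the jump rate at some point is not zero. If the rate at
  \<open>x\<close> is zero, then the kernel is zero and the divergence is just the mass \<open>l\<close>.

  Mass, mean and covariance of a Gaussian are obtained from the standard one: every
  \<open>\<Sigma>\<close> in \<open>SPD\<close> is \<open>P P\<^sup>T\<close> (\<open>SPD_factor\<close>), and \<open>N(\<mu>, P P\<^sup>T)\<close> is the image of the
  standard Gaussian measure under \<open>z \<mapsto> \<mu> + P z\<close> (\<open>gauss_measure_eq_distr\<close>), by the change of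
  variables formula \<open>lborel_linear\<close>.
\<close>

section \<open>Linear change of variables for Lebesgue measure\<close>

lemma measurable_vec_lambda_PiM[measurable]:
  "vec_lambda \<in> borel_measurable (Pi\<^sub>M UNIV (\<lambda>_::'n::finite. lborel :: real measure))"
  by (rule borel_measurable_euclidean_space[THEN iffD2]) (auto simp: Basis_vec_def inner_axis)

text \<open>
  Writing Lebesgue measure as a product measure makes two tools available on \<open>real^'n\<close>: integrating
  over one chosen coordinate first, and integrating products of functions of single coordinates.
\<close>
lemma lborel_vec_eq:
  "(lborel :: (real^'n) measure) = distr (Pi\<^sub>M UNIV (\<lambda>_. lborel)) borel vec_lambda"
proof (rule lborel_eqI)
  interpret product_sigma_finite "\<lambda>_::'n. lborel :: real measure" ..
  fix l u :: "real^'n" assume le: "\<And>b. b \<in> Basis \<Longrightarrow> l \<bullet> b \<le> u \<bullet> b"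
  have le': "l $ i \<le> u $ i" for i
    using le[of "axis i 1"] by (simp add: inner_axis axis_in_Basis_iff)
  have "vec_lambda -` box l u = Pi\<^sub>E UNIV (\<lambda>i. {l $ i <..< u $ i})"
    by (auto simp: box_def Basis_vec_def inner_axis PiE_def Pi_def)
  then have "emeasure (distr (Pi\<^sub>M UNIV (\<lambda>_. lborel)) borel vec_lambda) (box l u)
      = (\<Prod>i\<in>UNIV. ennreal (u $ i - l $ i))"
    using le' by (simp add: emeasure_distr space_PiM emeasure_PiM)
  also have "\<dots> = ennreal (\<Prod>i\<in>UNIV. u $ i - l $ i)"
    using le' by (subst prod_ennreal) auto
  also have "(\<Prod>i\<in>UNIV. u $ i - l $ i) = (\<Prod>b\<in>Basis. (u - l) \<bullet> b)"
  proof -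
    have "(\<Prod>b\<in>(\<lambda>i. axis i 1) ` UNIV. (u - l) \<bullet> b) = (\<Prod>i\<in>UNIV. (u - l) \<bullet> axis i 1)"
      by (subst prod.reindex) (auto simp: inj_on_def axis_eq_axis)
    moreover have "(Basis :: (real^'n) set) = (\<lambda>i. axis i 1) ` UNIV"
      by (auto simp: Basis_vec_def)
    ultimately show ?thesis by (simp add: inner_axis)
  qed
  finally show "emeasure (distr (Pi\<^sub>M UNIV (\<lambda>_. lborel)) borel vec_lambda) (box l u)
      = ennreal (\<Prod>b\<in>Basis. (u - l) \<bullet> b)" .
qed simp

lemma measurable_matrix_vector_mult[measurable]: "(\<lambda>x. A *v x) \<in> borel_measurable (borel :: (real^'n) measure)"
  by (intro borel_measurable_continuous_onI) (simp add: linear_continuous_on linear_conv_bounded_linear[symmetric])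

lemma measurable_vec_nth_borel[measurable]: "(\<lambda>x::real^'n. x $ i) \<in> borel_measurable borel"
  by (intro borel_measurable_continuous_onI continuous_intros)

lemma distr_lborel_diagonal:
  fixes A :: "real^'n^'n"
  assumes "\<And>i j. i \<noteq> j \<Longrightarrow> A $ i $ j = 0" and "det A \<noteq> 0"
  shows "lborel = density (distr lborel borel ((*v) A)) (\<lambda>_. ennreal \<bar>det A\<bar>)"
proof -
  define c where "c b = b \<bullet> (A *v b)" for b :: "real^'n"
  have d: "det A = (\<Prod>i\<in>UNIV. A $ i $ i)"
    using assms(1) by (rule det_diagonal)
  have B: "(Basis :: (real^'n) set) = (\<lambda>i. axis i 1) ` UNIV"
    by (auto simp: Basis_vec_def)
  have inj: "inj (\<lambda>i::'n. axis i (1::real))"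
    by (auto simp: inj_on_def axis_eq_axis)
  have c_axis: "c (axis i 1) = A $ i $ i" for i
    by (simp add: c_def matrix_vector_mult_basis column_def inner_axis' )
  have nz: "A $ i $ i \<noteq> 0" for i
    using assms(2) d by auto
  have diag: "(A *v x) $ i = A $ i $ i * x $ i" for x i
  proof -
    have "A $ i $ j * x $ j = (if j = i then A $ i $ i * x $ i else 0)" for j
      using assms(1)[of i j] by auto
    then have "(\<Sum>j\<in>UNIV. A $ i $ j * x $ j) = (\<Sum>j\<in>UNIV. if j = i then A $ i $ i * x $ i else 0)"
      by (intro sum.cong refl)
    then show ?thesis by (simp add: matrix_vector_mult_def)
  qed
  have T: "(\<lambda>x. 0 + (\<Sum>j\<in>Basis. (c j * (x \<bullet> j)) *\<^sub>R j)) = (*v) A"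
  proof
    fix x :: "real^'n"
    show "0 + (\<Sum>j\<in>Basis. (c j * (x \<bullet> j)) *\<^sub>R j) = A *v x"
    proof -
      have "(\<Sum>j\<in>Basis. (c j * (x \<bullet> j)) *\<^sub>R j) = (\<Sum>i\<in>UNIV. (A $ i $ i * x $ i) *\<^sub>R axis i 1)"
        unfolding B by (subst sum.reindex[OF inj]) (simp add: c_axis inner_axis)
      also have "\<dots> = A *v x"
        by (simp add: vec_eq_iff diag) (simp add: axis_def if_distrib cong: if_cong)
      finally show ?thesis by simp
    qed
  qed
  have P: "(\<Prod>j\<in>Basis. \<bar>c j\<bar>) = \<bar>det A\<bar>"
    unfolding B d using inj by (subst prod.reindex) (auto simp: c_axis abs_prod)
  have "c j \<noteq> 0" if "j \<in> Basis" for j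
    using that nz unfolding B by (auto simp: c_axis)
  from lborel_affine_euclidean[of c 0, OF this] show ?thesis
    unfolding T P .
qed

lemma distr_lborel_swap:
  fixes m n :: "'n::finite"
  assumes "m \<noteq> n"
  shows "distr lborel borel ((*v) (\<chi> i j. mat 1 $ i $ Transposition.transpose m n j))
      = (lborel :: (real^'n) measure)"
proof (rule lborel_eqI[symmetric])
  let ?s = "Transposition.transpose m n"
  have "((\<chi> i j. mat 1 $ i $ ?s j) *v x) $ i = x $ ?s i" for x :: "real^'n" and i
  proof -
    have "((\<chi> i j. mat 1 $ i $ ?s j) *v x) $ i = (\<Sum>j\<in>UNIV. if j = ?s i then x $ j else 0)"
      by (simp only: matrix_vector_mult_def vec_lambda_beta mat_def transpose_eq_iff)
        (rule sum.cong, auto)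
    then show ?thesis by simp
  qed
  then have eq: "(*v) (\<chi> i j. mat 1 $ i $ ?s j) = (\<lambda>x::real^'n. \<chi> i. x $ ?s i)"
    by (auto simp: vec_eq_iff)
  have [measurable]: "(\<lambda>x::real^'n. \<chi> i. x $ ?s i) \<in> borel_measurable borel"
    using measurable_matrix_vector_mult[of "(\<chi> i j. mat 1 $ i $ ?s j) :: real^'n^'n"]
    by (simp only: eq)
  fix l u :: "real^'n" assume le: "\<And>b. b \<in> Basis \<Longrightarrow> l \<bullet> b \<le> u \<bullet> b"
  have B: "(Basis :: (real^'n) set) = (\<lambda>i. axis i 1) ` UNIV"
    by (auto simp: Basis_vec_def)
  have inj: "inj (\<lambda>i::'n. axis i (1::real))"
    by (auto simp: inj_on_def axis_eq_axis)
  have le': "l $ i \<le> u $ i" for i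
    using le[of "axis i 1"] by (simp add: inner_axis axis_in_Basis_iff)
  have pre: "(\<lambda>x::real^'n. \<chi> i. x $ ?s i) -` box l u = box (\<chi> i. l $ ?s i) (\<chi> i. u $ ?s i)"
    by (auto simp: box_def B inner_axis) (metis transpose_involutory)+
  have "emeasure (distr lborel borel ((*v) (\<chi> i j. mat 1 $ i $ ?s j))) (box l u)
      = emeasure lborel (box (\<chi> i. l $ ?s i) (\<chi> i. u $ ?s i))"
    by (subst emeasure_distr) (simp_all add: eq pre[symmetric])
  also have "\<dots> = ennreal (\<Prod>i\<in>UNIV. u $ ?s i - l $ ?s i)"
    using le' inj by (subst emeasure_lborel_box) (auto simp: B prod.reindex inner_axis)
  also have "(\<Prod>i\<in>UNIV. u $ ?s i - l $ ?s i) = (\<Prod>i\<in>UNIV. u $ i - l $ i)"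
    by (rule prod.reindex_bij_betw[of ?s UNIV UNIV "\<lambda>i. u $ i - l $ i"]) simp
  also have "\<dots> = (\<Prod>b\<in>Basis. (u - l) \<bullet> b)"
    using inj by (auto simp: B prod.reindex inner_axis)
  finally show "emeasure (distr lborel borel ((*v) (\<chi> i j. mat 1 $ i $ ?s j))) (box l u)
      = ennreal (\<Prod>b\<in>Basis. (u - l) \<bullet> b)" .
qed simp

text \<open>
  With all coordinates other than \<open>m\<close> fixed, a shear translates coordinate \<open>m\<close> by a constant, and
  one-dimensional Lebesgue measure is translation invariant.
\<close>
lemma distr_lborel_shear:
  fixes m n :: "'n::finite" and c :: real
  assumes "m \<noteq> n"
  defines "S \<equiv> (\<chi> i j. if i = m \<and> j = n then c else of_bool (i = j)) :: real^'n^'n"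
  shows "distr lborel borel ((*v) S) = lborel"
proof (rule measure_eqI)
  interpret product_sigma_finite "\<lambda>_::'n. lborel :: real measure" ..
  have S: "(S *v x) $ i = (if i = m then x $ m + c * x $ n else x $ i)" for x i
  proof -
    have "(S *v x) $ i = (\<Sum>j\<in>UNIV. (if j = i then x $ i else 0) + (if j = n then (if i = m then c * x $ n else 0) else 0))"
      unfolding S_def matrix_vector_mult_def using assms(1) by (auto intro!: sum.cong)
    then show ?thesis by (simp add: sum.distrib)
  qed
  define I where "I = UNIV - {m}"
  have UI: "UNIV = insert m I" "m \<notin> I" "finite I" unfolding I_def by auto
  fix X assume "X \<in> sets (distr lborel borel ((*v) S))"
  then have [measurable]: "X \<in> sets borel" by simp
  have rep: "(\<integral>\<^sup>+ x. f x \<partial>lborel) = (\<integral>\<^sup>+ z. \<integral>\<^sup>+ y. f (vec_lambda (z(m := y))) \<partial>lborel \<partial>(Pi\<^sub>M I (\<lambda>_. lborel)))"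
    if [measurable]: "f \<in> borel_measurable borel" for f :: "real^'n \<Rightarrow> ennreal"
  proof -
    have "(\<integral>\<^sup>+ x. f x \<partial>lborel) = (\<integral>\<^sup>+ z. f (vec_lambda z) \<partial>(Pi\<^sub>M UNIV (\<lambda>_. lborel)))"
      by (subst lborel_vec_eq, subst nn_integral_distr) auto
    also have "\<dots> = (\<integral>\<^sup>+ z. f (vec_lambda z) \<partial>(Pi\<^sub>M (insert m I) (\<lambda>_. lborel)))"
      using UI(1) by simp
    also have "\<dots> = (\<integral>\<^sup>+ z. \<integral>\<^sup>+ y. f (vec_lambda (z(m := y))) \<partial>lborel \<partial>(Pi\<^sub>M I (\<lambda>_. lborel)))"
    proof (rule product_nn_integral_insert)
      have "(\<lambda>z. f (vec_lambda z)) \<in> borel_measurable (Pi\<^sub>M UNIV (\<lambda>_. lborel))" by measurable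
      then show "(\<lambda>z. f (vec_lambda z)) \<in> borel_measurable (Pi\<^sub>M (insert m I) (\<lambda>_. lborel))"
        using UI(1) by simp
    qed (use UI in auto)
    finally show ?thesis .
  qed
  have "emeasure (distr lborel borel ((*v) S)) X = (\<integral>\<^sup>+ x. indicator X (S *v x) \<partial>lborel)"
    by (subst nn_integral_indicator[symmetric], simp, subst nn_integral_distr) auto
  also have "\<dots> = (\<integral>\<^sup>+ z. \<integral>\<^sup>+ y. indicator X (S *v vec_lambda (z(m := y))) \<partial>lborel \<partial>(Pi\<^sub>M I (\<lambda>_. lborel)))"
    by (rule rep) measurable
  also have "\<dots> = (\<integral>\<^sup>+ z. \<integral>\<^sup>+ y. indicator X (vec_lambda (z(m := y))) \<partial>lborel \<partial>(Pi\<^sub>M I (\<lambda>_. lborel)))"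
  proof (rule nn_integral_cong)
    fix z :: "'n \<Rightarrow> real"
    have [measurable]: "(\<lambda>y. vec_lambda (z(m := y))) \<in> borel_measurable borel"
      by (rule borel_measurable_euclidean_space[THEN iffD2]) (auto simp: Basis_vec_def inner_axis fun_upd_def)
    \<comment> \<open>the factor 1 matches the affine form \<open>t + c * x\<close> of the substitution rule\<close>
    have *: "S *v vec_lambda (z(m := y)) = vec_lambda (z(m := c * z n + 1 * y))" for y
      using assms(1) by (auto simp: vec_eq_iff S)
    show "(\<integral>\<^sup>+ y. indicator X (S *v vec_lambda (z(m := y))) \<partial>lborel) = (\<integral>\<^sup>+ y. indicator X (vec_lambda (z(m := y))) \<partial>lborel)"
      unfolding * by (subst (2) nn_integral_real_affine[where c=1 and t="c * z n"]) auto
  qed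
  also have "\<dots> = (\<integral>\<^sup>+ x. indicator X x \<partial>lborel)"
    by (rule rep[symmetric]) measurable
  also have "\<dots> = emeasure lborel X" by simp
  finally show "emeasure (distr lborel borel ((*v) S)) X = emeasure lborel X" .
qed simp

text \<open>
  Composing two linear maps multiplies both the volume factors and the determinants, so it suffices
  to treat the factors in a decomposition of \<open>A\<close> into diagonal matrices, swaps and shears.
\<close>
theorem lborel_linear:
  fixes A :: "real^'n^'n"
  assumes "det A \<noteq> 0"
  shows "lborel = density (distr lborel borel ((*v) A)) (\<lambda>_. ennreal \<bar>det A\<bar>)"
  using assms
proof (induction A rule: induct_matrix_elementary)
  case (1 A B)
  then have A: "lborel = density (distr lborel borel ((*v) A)) (\<lambda>_. ennreal \<bar>det A\<bar>)"
    and B: "lborel = density (distr lborel borel ((*v) B)) (\<lambda>_. ennreal \<bar>det B\<bar>)"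
    by (auto simp: det_mul)
  have "lborel = density (distr (density (distr lborel borel ((*v) B)) (\<lambda>_. ennreal \<bar>det B\<bar>)) borel ((*v) A)) (\<lambda>_. ennreal \<bar>det A\<bar>)"
    using A by (subst B[symmetric])
  also have "\<dots> = density (distr (distr lborel borel ((*v) B)) borel ((*v) A)) (\<lambda>x. ennreal \<bar>det B\<bar> * ennreal \<bar>det A\<bar>)"
    by (subst density_distr[symmetric]) (auto simp: density_density_eq)
  also have "distr (distr lborel borel ((*v) B)) borel ((*v) A) = distr lborel borel ((*v) (A ** B))"
    by (subst distr_distr) (auto simp: matrix_vector_mult_matrix_matrix_mult_compose)
  finally show ?case
    by (simp add: det_mul ennreal_mult'[symmetric] abs_mult mult.commute)
next
  case (2 A i)
  then show ?case using det_zero_row(2)[of i A] by simp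
next
  case (3 A)
  then show ?case by (rule distr_lborel_diagonal)
next
  case (4 m n)
  have "det (\<chi> i j. mat 1 $ i $ Transposition.transpose m n j :: real^'n^'n) = - 1"
    using 4 det_permute_columns[of "Transposition.transpose m n" "mat 1 :: real^'n^'n"]
    by (simp add: permutes_swap_id sign_swap_id)
  then show ?case using 4 by (simp add: distr_lborel_swap density_1)
next
  case (5 m n c)
  have "det (\<chi> i j. if i = m \<and> j = n then c else of_bool (i = j) :: real^'n^'n) = 1"
  proof -
    have "(\<chi> i j. if i = m \<and> j = n then c else of_bool (i = j) :: real^'n^'n)
       = (\<chi> k. if k = m then row m (mat 1) + c *s row n (mat 1) else row k (mat 1))"
      using 5 by (auto simp: vec_eq_iff row_def mat_def)
    then show ?thesis using det_row_operation[OF 5(1), of "mat 1 :: real^'n^'n" c] by simp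
  qed
  then show ?case using 5 by (simp add: distr_lborel_shear density_1)
qed

section \<open>Gaussian measures as affine images of the standard Gaussian\<close>

text \<open>
  Gram-Schmidt for the inner product \<open>v \<bullet> (A *v w)\<close>: as long as \<open>S\<close> has fewer than \<open>CARD('n)\<close>
  elements, the vectors \<open>A *v v\<close> with \<open>v \<in> S\<close> span a proper subspace, and a vector orthogonal to
  that subspace can be normalised and added to \<open>S\<close>.
\<close>
lemma exists_orthonormal_wrt:
  fixes A :: "real^'n^'n"
  assumes "A \<in> SPD" and "k \<le> CARD('n)"
  shows "\<exists>S. finite S \<and> card S = k \<and> (\<forall>v\<in>S. \<forall>w\<in>S. v \<bullet> (A *v w) = of_bool (v = w))"
  using assms(2)
proof (induction k)
  case 0
  show ?case by (rule exI[of _ "{}"]) auto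
next
  case (Suc k)
  have "transpose A = A" using assms(1) by (simp add: SPD_def)
  then have sym: "v \<bullet> (A *v w) = w \<bullet> (A *v v)" for v w
    using dot_lmul_matrix[of v A w] transpose_matrix_vector[of A v] by (simp add: inner_commute)
  from Suc obtain S where S: "finite S" "card S = k"
    and orth: "\<forall>v\<in>S. \<forall>w\<in>S. v \<bullet> (A *v w) = of_bool (v = w)" by auto
  have "dim ((*v) A ` S) \<le> card ((*v) A ` S)" using S by (intro dim_le_card') auto
  also have "\<dots> \<le> k" using S card_image_le by blast
  finally have "dim ((*v) A ` S) < DIM(real^'n)" using Suc.prems by simp
  then obtain x where x: "x \<noteq> 0" "\<And>y. y \<in> span ((*v) A ` S) \<Longrightarrow> orthogonal x y"
    using orthogonal_to_subspace_exists[of "(*v) A ` S"] by auto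
  have x0: "x \<bullet> (A *v v) = 0" if "v \<in> S" for v
    using x(2) that by (auto simp: orthogonal_def span_base)
  have pos: "x \<bullet> (A *v x) > 0" using assms(1) x(1) by (auto simp: SPD_def pos_definite_def)
  \<comment> \<open>the extension of \<open>S\<close>: \<open>x\<close> scaled to length 1 for the inner product given by \<open>A\<close>\<close>
  define w where "w = (1 / sqrt (x \<bullet> (A *v x))) *\<^sub>R x"
  have w1: "w \<bullet> (A *v w) = 1"
    using pos by (simp add: w_def matrix_vector_mult_scaleR)
  have w0: "w \<bullet> (A *v v) = 0" "v \<bullet> (A *v w) = 0" if "v \<in> S" for v
    using x0[OF that] sym[of v w] by (auto simp: w_def)
  have "w \<notin> S" using w0 w1 by force
  then show ?case
    using S orth w0 w1 by (intro exI[of _ "insert w S"]) auto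
qed

text \<open>
  A basis that is orthonormal for \<open>v \<bullet> (\<Sigma> *v w)\<close>, written as the rows of \<open>Q\<close>, satisfies
  \<open>Q \<Sigma> Q\<^sup>T = 1\<close>; the factor is the inverse of \<open>Q\<close>.
\<close>
lemma SPD_factor:
  fixes \<Sigma> :: "real^'n^'n"
  assumes "\<Sigma> \<in> SPD"
  obtains P where "det P \<noteq> 0" "\<Sigma> = P ** transpose P"
proof -
  obtain S where S: "finite S" "card S = CARD('n)"
    and orth: "\<forall>v\<in>S. \<forall>w\<in>S. v \<bullet> (\<Sigma> *v w) = of_bool (v = w)"
    using exists_orthonormal_wrt[OF assms order_refl] by blast
  obtain h :: "'n \<Rightarrow> real^'n" where h: "bij_betw h UNIV S"
    using S finite_same_card_bij[of "UNIV :: 'n set" S] by auto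
  define Q :: "real^'n^'n" where "Q = (\<chi> i. h i)"
  have "(Q ** \<Sigma> ** transpose Q) $ i $ j = h i \<bullet> (\<Sigma> *v h j)" for i j
    unfolding matrix_mul_assoc[symmetric]
    by (simp add: matrix_matrix_mult_def matrix_vector_mult_def inner_vec_def Q_def transpose_def)
  moreover have "h i \<bullet> (\<Sigma> *v h j) = of_bool (i = j)" for i j
    using orth h by (auto simp: bij_betw_def inj_on_def)
  ultimately have Q: "Q ** \<Sigma> ** transpose Q = mat 1"
    by (simp add: vec_eq_iff mat_def)
  then have "det (Q ** \<Sigma> ** transpose Q) = 1" by simp
  then have "invertible Q" by (auto simp: invertible_det_nz det_mul)
  then obtain P where P: "Q ** P = mat 1" "P ** Q = mat 1" by (auto simp: invertible_def)
  have PT: "transpose Q ** transpose P = mat 1"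
    using P(2) by (metis matrix_transpose_mul transpose_mat)
  have "\<Sigma> = (P ** Q) ** \<Sigma> ** (transpose Q ** transpose P)"
    by (simp add: P PT)
  also have "\<dots> = P ** (Q ** \<Sigma> ** transpose Q) ** transpose P"
    by (simp only: matrix_mul_assoc)
  finally have "\<Sigma> = P ** transpose P" by (simp add: Q)
  moreover have "det P \<noteq> 0" using P(1) by (metis det_I det_mul mult_zero_right zero_neq_one)
  ultimately show ?thesis using that by blast
qed

lemma matrix_inv_eqI:
  fixes A :: "real^'n^'n"
  assumes "A ** B = mat 1"
  shows "matrix_inv A = B"
proof -
  have BA: "B ** A = mat 1" using assms matrix_left_right_inverse by blast
  then have "\<exists>C. A ** C = mat 1 \<and> C ** A = mat 1" using assms by blast
  then have "A ** matrix_inv A = mat 1 \<and> matrix_inv A ** A = mat 1"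
    unfolding matrix_inv_def by (rule someI_ex)
  then have "matrix_inv A ** (A ** B) = (mat 1 :: real^'n^'n) ** B"
    by (simp add: matrix_mul_assoc)
  then show ?thesis by (simp add: assms)
qed

text \<open>
  With \<open>Q\<close> the inverse of \<open>P\<close>, the inverse of \<open>P P\<^sup>T\<close> is \<open>Q\<^sup>T Q\<close>. This is what turns the exponent of a
  general Gaussian into that of the standard one.
\<close>
lemma SPD_inv_form:
  fixes P :: "real^'n^'n"
  assumes "det P \<noteq> 0"
  shows "(P *v z) \<bullet> (matrix_inv (P ** transpose P) *v (P *v z)) = (norm z)\<^sup>2"
proof -
  obtain Q where Q: "P ** Q = mat 1" "Q ** P = mat 1"
    using assms by (auto simp: invertible_det_nz[symmetric] invertible_def)
  have QT: "transpose P ** transpose Q = mat 1" 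
    using Q(2) by (metis matrix_transpose_mul transpose_mat)
  have "(P ** transpose P) ** (transpose Q ** Q) = P ** (transpose P ** transpose Q) ** Q"
    by (simp only: matrix_mul_assoc)
  then have "matrix_inv (P ** transpose P) = transpose Q ** Q"
    by (intro matrix_inv_eqI) (simp add: QT Q)
  then have "matrix_inv (P ** transpose P) *v (P *v z) = transpose Q *v ((Q ** P) *v z)"
    by (simp add: matrix_vector_mul_assoc matrix_mul_assoc)
  also have "\<dots> = transpose Q *v z" by (simp add: Q)
  finally have "(P *v z) \<bullet> (matrix_inv (P ** transpose P) *v (P *v z)) = (P *v z) \<bullet> (transpose Q *v z)"
    by simp
  also have "\<dots> = z \<bullet> (Q *v (P *v z))"
    by (metis dot_lmul_matrix inner_commute transpose_matrix_vector)
  also have "\<dots> = (norm z)\<^sup>2"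
    by (simp add: matrix_vector_mul_assoc Q power2_norm_eq_inner)
  finally show ?thesis .
qed

lemma det_SPD_pos: "\<Sigma> \<in> SPD \<Longrightarrow> det \<Sigma> > 0"
  by (erule SPD_factor) (auto simp: det_mul zero_less_mult_iff linorder_neq_iff)

lemma gauss_density_pos: "\<Sigma> \<in> SPD \<Longrightarrow> gauss_density \<mu> \<Sigma> y > 0"
  by (simp add: gauss_density_def det_SPD_pos)

lemma measurable_gauss_density[measurable]:
  "gauss_density \<mu> \<Sigma> \<in> borel_measurable borel"
  unfolding gauss_density_def by measurable

lemma matrix_inv_mat_1: "matrix_inv (mat 1 :: real^'n^'n) = mat 1"
  by (rule matrix_inv_eqI) simp

lemma gauss_density_std:
  "gauss_density 0 (mat 1) (z::real^'n) = (\<Prod>i\<in>UNIV. std_normal_density (z $ i))"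
proof -
  have "(\<Prod>i\<in>UNIV. std_normal_density (z $ i)) = exp (\<Sum>i\<in>UNIV. - (z $ i)\<^sup>2 / 2) / sqrt (2 * pi) ^ CARD('n)"
    by (simp add: std_normal_density_def prod.distrib exp_sum prod_dividef)
  also have "(\<Sum>i\<in>UNIV. - (z $ i)\<^sup>2 / 2) = - (z \<bullet> z) / 2"
    by (simp add: inner_vec_def sum_negf sum_divide_distrib power2_eq_square)
  finally show ?thesis
    by (simp add: gauss_density_def matrix_inv_mat_1 real_sqrt_power[symmetric] power_mult_distrib)
qed

text \<open>
  The factor \<open>\<bar>det P\<bar>\<close> is the square root of \<open>det (P P\<^sup>T)\<close> from the normalising constant.
\<close>
lemma gauss_density_affine:
  fixes P :: "real^'n^'n"
  assumes "det P \<noteq> 0"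
  shows "gauss_density \<mu> (P ** transpose P) (\<mu> + P *v z) * \<bar>det P\<bar> = gauss_density 0 (mat 1) z"
proof -
  have "sqrt (x * (d * d)) = sqrt x * \<bar>d\<bar>" for x d :: real
    by (simp add: real_sqrt_mult)
  then show ?thesis
    using assms by (simp add: gauss_density_def SPD_inv_form matrix_inv_mat_1 det_mul power2_norm_eq_inner)
qed

text \<open>
  The Jacobian of \<open>z \<mapsto> \<mu> + P z\<close> is exactly the factor in \<open>gauss_density_affine\<close>. Integrals against any
  Gaussian thereby become integrals against the standard Gaussian.
\<close>
theorem gauss_measure_eq_distr:
  fixes P :: "real^'n^'n"
  assumes "det P \<noteq> 0"
  shows "density lborel (\<lambda>y. ennreal (gauss_density \<mu> (P ** transpose P) y))
     = distr (density lborel (\<lambda>z. ennreal (gauss_density 0 (mat 1) z))) borel (\<lambda>z. \<mu> + P *v z)"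
proof -
  let ?g = "\<lambda>y. ennreal (gauss_density \<mu> (P ** transpose P) y)"
  have "lborel = distr lborel borel ((+) \<mu>)" by (simp add: lborel_distr_plus)
  also have "\<dots> = distr (density (distr lborel borel ((*v) P)) (\<lambda>_. ennreal \<bar>det P\<bar>)) borel ((+) \<mu>)"
    using lborel_linear[OF assms] by simp
  also have "\<dots> = density (distr (distr lborel borel ((*v) P)) borel ((+) \<mu>)) (\<lambda>_. ennreal \<bar>det P\<bar>)"
    by (rule density_distr[symmetric]) auto
  also have "distr (distr lborel borel ((*v) P)) borel ((+) \<mu>) = distr lborel borel (\<lambda>z. \<mu> + P *v z)"
    by (subst distr_distr) (auto simp: o_def)
  finally have L: "lborel = density (distr lborel borel (\<lambda>z. \<mu> + P *v z)) (\<lambda>_. ennreal \<bar>det P\<bar>)" .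
  have "density lborel ?g = density (distr lborel borel (\<lambda>z. \<mu> + P *v z)) (\<lambda>y. ennreal \<bar>det P\<bar> * ?g y)"
    by (subst L, subst density_density_eq) auto
  also have "\<dots> = distr (density lborel (\<lambda>z. ennreal \<bar>det P\<bar> * ?g (\<mu> + P *v z))) borel (\<lambda>z. \<mu> + P *v z)"
    by (subst density_distr) auto
  also have "(\<lambda>z. ennreal \<bar>det P\<bar> * ?g (\<mu> + P *v z)) = (\<lambda>z. ennreal (gauss_density 0 (mat 1) z))"
    by (intro ext, subst gauss_density_affine[OF assms, symmetric, of _ \<mu>])
      (simp add: ennreal_mult'[symmetric] mult.commute)
  finally show ?thesis .
qed

section \<open>Mean and covariance\<close>

text \<open>
  The standard Gaussian density is a product over the coordinates, so the integral of a product of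
  one-variable functions factorises.
\<close>
lemma std_gauss_product_integral:
  fixes h :: "'n::finite \<Rightarrow> real \<Rightarrow> real"
  assumes int: "\<And>i. has_bochner_integral lborel (\<lambda>x. std_normal_density x * h i x) (c i)"
    and [measurable]: "\<And>i. h i \<in> borel_measurable borel"
  shows "has_bochner_integral lborel
    (\<lambda>z::real^'n. gauss_density 0 (mat 1) z * (\<Prod>i\<in>UNIV. h i (z $ i))) (\<Prod>i\<in>UNIV. c i)"
proof -
  interpret product_sigma_finite "\<lambda>_::'n. lborel :: real measure" ..
  let ?f = "\<lambda>i x. std_normal_density x * h i x"
  let ?F = "\<lambda>z::real^'n. gauss_density 0 (mat 1) z * (\<Prod>i\<in>UNIV. h i (z $ i))"
  have [measurable]: "?F \<in> borel_measurable borel" by measurable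
  have F: "gauss_density 0 (mat 1) (vec_lambda x) * (\<Prod>i\<in>UNIV. h i (x i)) = (\<Prod>i\<in>UNIV. ?f i (x i))" for x
    by (simp add: gauss_density_std prod.distrib)
  have i: "integrable lborel (?f i)" "(\<integral>x. ?f i x \<partial>lborel) = c i" for i
    using int[of i] by (auto simp: has_bochner_integral_iff)
  have "integrable (Pi\<^sub>M UNIV (\<lambda>_. lborel)) (\<lambda>x. \<Prod>i\<in>UNIV. ?f i (x i))"
    using i by (intro product_integrable_prod) auto
  then have "integrable lborel ?F"
    by (subst lborel_vec_eq, subst integrable_distr_eq) (simp_all add: F)
  moreover have "(\<integral>z. ?F z \<partial>lborel) = (\<integral>x. (\<Prod>i\<in>UNIV. ?f i (x i)) \<partial>Pi\<^sub>M UNIV (\<lambda>_. lborel))"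
    by (subst lborel_vec_eq, subst integral_distr) (simp_all add: F)
  moreover have "\<dots> = (\<Prod>i\<in>UNIV. c i)"
    using i by (subst product_integral_prod) auto
  ultimately show ?thesis by (simp add: has_bochner_integral_iff)
qed

abbreviation gauss_measure :: "real^'n \<Rightarrow> real^'n^'n \<Rightarrow> (real^'n) measure" where
  "gauss_measure \<mu> \<Sigma> \<equiv> density lborel (\<lambda>y. ennreal (gauss_density \<mu> \<Sigma> y))"

lemma mat_1_SPD: "(mat 1 :: real^'n^'n) \<in> SPD"
  by (simp add: SPD_def pos_definite_def)

lemma prob_space_std_gauss: "prob_space (gauss_measure 0 (mat 1 :: real^'n^'n))"
proof -
  have h: "has_bochner_integral lborel (\<lambda>z::real^'n. gauss_density 0 (mat 1) z) 1"
    using std_gauss_product_integral[of "\<lambda>_ _. 1" "\<lambda>_::'n. 1"] std_normal_moment_even[of 0] by simp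
  have "emeasure (gauss_measure 0 (mat 1 :: real^'n^'n)) UNIV
      = (\<integral>\<^sup>+ z. ennreal (gauss_density 0 (mat 1) (z::real^'n)) \<partial>lborel)"
    by (simp add: emeasure_density)
  also have "\<dots> = 1"
    using h by (subst nn_integral_eq_integral)
      (auto simp: has_bochner_integral_iff less_imp_le gauss_density_pos mat_1_SPD)
  finally show ?thesis by (intro prob_spaceI) simp
qed

text \<open>
  Both \<open>z $ i\<close> and \<open>z $ i * z $ j\<close> are products of powers of single coordinates with exponents at
  most 2, so only the one-dimensional moments 1, 0, 1 of orders 0, 1, 2 enter.
\<close>
lemma std_gauss_moments:
  fixes i j :: "'n::finite"
  shows "has_bochner_integral (gauss_measure 0 (mat 1)) (\<lambda>z::real^'n. z $ i) 0"
    and "has_bochner_integral (gauss_measure 0 (mat 1)) (\<lambda>z::real^'n. z $ i * z $ j) (of_bool (i = j))"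
proof -
  have std: "has_bochner_integral lborel (\<lambda>x. std_normal_density x * x ^ k) (if k = 1 then 0 else 1)"
    if "k \<le> 2" for k :: nat
  proof -
    consider "k = 0" | "k = 1" | "k = 2" using \<open>k \<le> 2\<close> by linarith
    then show ?thesis
      using std_normal_moment_even[of 0] std_normal_moment_odd[of 0] std_normal_moment_even[of 1]
      by cases auto
  qed
  have one: "(\<Prod>k\<in>UNIV. (z $ k) ^ of_bool (k = i)) = z $ i" for z :: "real^'n" and i
    by (simp add: of_bool_def if_distrib cong: if_cong)
  have dens: "has_bochner_integral (gauss_measure 0 (mat 1)) f c"
    if "has_bochner_integral lborel (\<lambda>z. gauss_density 0 (mat 1) z * f z) c"
      and [measurable]: "f \<in> borel_measurable borel" for f :: "real^'n \<Rightarrow> real" and c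
    using that(1) by (intro has_bochner_integral_density)
      (auto simp: less_imp_le gauss_density_pos mat_1_SPD)
  have "has_bochner_integral lborel
      (\<lambda>z::real^'n. gauss_density 0 (mat 1) z * (\<Prod>k\<in>UNIV. (z $ k) ^ of_bool (k = i)))
      (\<Prod>k\<in>UNIV. if of_bool (k = i) = (1::nat) then 0 else 1)"
    by (rule std_gauss_product_integral) (rule std, simp, simp)
  moreover have "(\<Prod>k\<in>UNIV. if of_bool (k = i) = (1::nat) then 0 else (1::real)) = 0"
    by (rule prod_zero) auto
  ultimately show "has_bochner_integral (gauss_measure 0 (mat 1)) (\<lambda>z::real^'n. z $ i) 0"
    by (intro dens) (simp_all only: one, measurable)
  \<comment> \<open>the exponent of coordinate \<open>k\<close> in \<open>z $ i * z $ j\<close>, which is 2 if \<open>k = i = j\<close>\<close>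
  let ?e = "\<lambda>k. of_bool (k = i) + of_bool (k = j) :: nat"
  have "has_bochner_integral lborel
      (\<lambda>z::real^'n. gauss_density 0 (mat 1) z * (\<Prod>k\<in>UNIV. (z $ k) ^ ?e k))
      (\<Prod>k\<in>UNIV. if ?e k = 1 then 0 else 1)"
    by (rule std_gauss_product_integral) (rule std, simp, simp)
  moreover have "(\<Prod>k\<in>UNIV. if ?e k = 1 then 0 else 1) = (of_bool (i = j) :: real)"
  proof (cases "i = j")
    case True
    then show ?thesis by (auto intro!: prod.neutral)
  next
    case False
    then have "?e i = 1" by simp
    then have "(\<Prod>k\<in>UNIV. if ?e k = 1 then 0 else (1::real)) = 0"
      by (intro prod_zero) auto
    then show ?thesis using False by simp
  qed
  moreover have "(\<Prod>k\<in>UNIV. (z $ k) ^ ?e k) = z $ i * z $ j" for z :: "real^'n"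
    by (simp add: power_add prod.distrib one)
  ultimately show "has_bochner_integral (gauss_measure 0 (mat 1)) (\<lambda>z::real^'n. z $ i * z $ j) (of_bool (i = j))"
    by (intro dens) auto
qed

lemma gauss_moments:
  fixes \<mu> :: "real^'n" and i j :: 'n
  assumes "\<Sigma> \<in> SPD"
  shows "prob_space (gauss_measure \<mu> \<Sigma>)"
    and "has_bochner_integral (gauss_measure \<mu> \<Sigma>) (\<lambda>y. y $ i) (\<mu> $ i)"
    and "has_bochner_integral (gauss_measure \<mu> \<Sigma>) (\<lambda>y. (y $ i - \<mu> $ i) * (y $ j - \<mu> $ j)) (\<Sigma> $ i $ j)"
proof -
  obtain P where P: "det P \<noteq> 0" "\<Sigma> = P ** transpose P" using SPD_factor[OF assms] .
  let ?M = "gauss_measure 0 (mat 1) :: (real^'n) measure"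
  interpret M: prob_space ?M by (rule prob_space_std_gauss)
  have [simp]: "M.prob UNIV = 1" using M.prob_space by simp
  have T[measurable]: "(\<lambda>z. \<mu> + P *v z) \<in> ?M \<rightarrow>\<^sub>M borel" by measurable
  have N: "gauss_measure \<mu> \<Sigma> = distr ?M borel (\<lambda>z. \<mu> + P *v z)"
    using gauss_measure_eq_distr[OF P(1)] P(2) by simp
  have tr: "has_bochner_integral (gauss_measure \<mu> \<Sigma>) f c"
    if "has_bochner_integral ?M (\<lambda>z. f (\<mu> + P *v z)) c" "f \<in> borel_measurable borel"
    for f :: "real^'n \<Rightarrow> real" and c
    unfolding N using has_bochner_integral_distr[OF that(2) T] that(1) by simp
  show "prob_space (gauss_measure \<mu> \<Sigma>)"
    unfolding N by (rule M.prob_space_distr) measurable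
  have comp: "(\<mu> + P *v z) $ i = \<mu> $ i + (\<Sum>k\<in>UNIV. P $ i $ k * z $ k)" for z i
    by (simp add: matrix_vector_mult_def)
  have "has_bochner_integral ?M (\<lambda>z. \<mu> $ i + (\<Sum>k\<in>UNIV. P $ i $ k * z $ k)) (\<mu> $ i + (\<Sum>k\<in>UNIV. P $ i $ k * 0))"
    by (intro has_bochner_integral_add has_bochner_integral_sum has_bochner_integral_mult_right std_gauss_moments)
      (auto simp: has_bochner_integral_iff M.prob_space)
  then show "has_bochner_integral (gauss_measure \<mu> \<Sigma>) (\<lambda>y. y $ i) (\<mu> $ i)"
    by (intro tr) (simp_all only: comp sum.neutral_const mult_zero_right add_0_right, measurable)
  have "has_bochner_integral ?M (\<lambda>z. \<Sum>k\<in>UNIV. \<Sum>l\<in>UNIV. P $ i $ k * P $ j $ l * (z $ k * z $ l))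
      (\<Sum>k\<in>UNIV. \<Sum>l\<in>UNIV. P $ i $ k * P $ j $ l * of_bool (k = l))"
    by (intro has_bochner_integral_sum has_bochner_integral_mult_right std_gauss_moments)
  moreover have "(\<Sum>k\<in>UNIV. \<Sum>l\<in>UNIV. P $ i $ k * P $ j $ l * of_bool (k = l)) = \<Sigma> $ i $ j"
    by (simp add: P(2) matrix_matrix_mult_def transpose_def of_bool_def if_distrib cong: if_cong)
  moreover have "(\<Sum>k\<in>UNIV. \<Sum>l\<in>UNIV. P $ i $ k * P $ j $ l * (z $ k * z $ l))
     = ((\<mu> + P *v z) $ i - \<mu> $ i) * ((\<mu> + P *v z) $ j - \<mu> $ j)" for z
    unfolding comp by (simp add: sum_product algebra_simps)
  ultimately show "has_bochner_integral (gauss_measure \<mu> \<Sigma>) (\<lambda>y. (y $ i - \<mu> $ i) * (y $ j - \<mu> $ j)) (\<Sigma> $ i $ j)"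
    by (intro tr) (auto)
qed

text \<open>
  The total mass is finite and \<open>norm y \<le> 1 + (norm y)\<^sup>2\<close>, so square integrability gives integrability;
  this is what allows the vector integral \<open>mean_vector\<close> to be evaluated in each coordinate.
\<close>
lemma square_integrable_components:
  fixes M :: "(real^'n) measure"
  assumes "prob_space M" and [measurable_cong, simp]: "sets M = sets borel"
    and int: "integrable M (\<lambda>y. (norm y)\<^sup>2)"
  shows "integrable M (\<lambda>y. y)" "integrable M (\<lambda>y. y $ i)" "integrable M (\<lambda>y. y $ i * y $ j)"
    "mean_vector M $ i = (\<integral>y. y $ i \<partial>M)"
proof -
  interpret prob_space M by fact
  have b: "integrable M (\<lambda>y. 1 + (norm y)\<^sup>2)" using int by simp
  show id: "integrable M (\<lambda>y. y)"
  proof (rule Bochner_Integration.integrable_bound[OF b])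
    show "AE y in M. norm y \<le> norm (1 + (norm y)\<^sup>2)"
    proof (rule AE_I2)
      fix y :: "real^'n"
      have "0 \<le> (norm y - 1)\<^sup>2" by simp
      then show "norm y \<le> norm (1 + (norm y)\<^sup>2)" by (simp add: power2_diff) (smt (verit) norm_ge_zero)
    qed
  qed measurable
  show "integrable M (\<lambda>y. y $ i)"
    by (rule integrable_bounded_linear[OF bounded_linear_vec_nth id])
  show "mean_vector M $ i = (\<integral>y. y $ i \<partial>M)"
    unfolding mean_vector_def by (rule integral_bounded_linear[OF bounded_linear_vec_nth id, symmetric])
  show "integrable M (\<lambda>y. y $ i * y $ j)"
  proof (rule Bochner_Integration.integrable_bound[OF int])
    show "AE y in M. norm (y $ i * y $ j) \<le> norm ((norm y)\<^sup>2)"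
      by (rule AE_I2) (auto simp: abs_mult power2_eq_square intro!: mult_mono component_le_norm_cart)
  qed measurable
qed

text \<open>
  The bias-variance decomposition: after writing \<open>y - \<mu>\<close> as \<open>(y - m) + (m - \<mu>)\<close> with the mean \<open>m\<close>, the
  mixed terms integrate to 0. It shows that only the first two moments of a density enter its
  divergence from a Gaussian.
\<close>
lemma quadratic_form_expectation:
  fixes M :: "(real^'n) measure" and \<mu> :: "real^'n" and A :: "real^'n^'n"
  assumes M: "prob_space M" "sets M = sets borel" "integrable M (\<lambda>y. (norm y)\<^sup>2)"
  shows "has_bochner_integral M (\<lambda>y. (y - \<mu>) \<bullet> (A *v (y - \<mu>)))
    (trace (transpose A ** covariance_matrix M) + (mean_vector M - \<mu>) \<bullet> (A *v (mean_vector M - \<mu>)))"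
proof -
  interpret prob_space M by fact
  let ?m = "mean_vector M"
  note c = square_integrable_components[OF M]
  have q: "v \<bullet> (A *v v) = (\<Sum>i\<in>UNIV. \<Sum>j\<in>UNIV. A $ i $ j * (v $ i * v $ j))" for v
    by (simp add: inner_vec_def matrix_vector_mult_def sum_distrib_left algebra_simps)
  have m1: "has_bochner_integral M (\<lambda>y. y $ i - ?m $ i) 0" for i
    using c(2)[of i] c(4)[of i] by (auto simp: has_bochner_integral_iff prob_space)
  have cov: "has_bochner_integral M (\<lambda>y. (y $ i - ?m $ i) * (y $ j - ?m $ j)) (covariance_matrix M $ i $ j)" for i j
    unfolding has_bochner_integral_iff covariance_matrix_def using c
    by (auto simp: algebra_simps)
  have "has_bochner_integral M (\<lambda>y. (y $ i - ?m $ i) * (y $ j - ?m $ j)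
        + (?m $ j - \<mu> $ j) * (y $ i - ?m $ i) + (?m $ i - \<mu> $ i) * (y $ j - ?m $ j)
        + (?m $ i - \<mu> $ i) * (?m $ j - \<mu> $ j))
      (covariance_matrix M $ i $ j + (?m $ j - \<mu> $ j) * 0 + (?m $ i - \<mu> $ i) * 0
        + (?m $ i - \<mu> $ i) * (?m $ j - \<mu> $ j))" for i j
    by (intro has_bochner_integral_add has_bochner_integral_mult_right cov m1)
      (auto simp: has_bochner_integral_iff prob_space)
  then have "has_bochner_integral M (\<lambda>y. (y $ i - \<mu> $ i) * (y $ j - \<mu> $ j))
      (covariance_matrix M $ i $ j + (?m $ i - \<mu> $ i) * (?m $ j - \<mu> $ j))" for i j
    by (simp add: algebra_simps)
  then have "has_bochner_integral M (\<lambda>y. \<Sum>i\<in>UNIV. \<Sum>j\<in>UNIV. A $ i $ j * ((y $ i - \<mu> $ i) * (y $ j - \<mu> $ j)))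
     (\<Sum>i\<in>UNIV. \<Sum>j\<in>UNIV. A $ i $ j * (covariance_matrix M $ i $ j + (?m $ i - \<mu> $ i) * (?m $ j - \<mu> $ j)))"
    by (intro has_bochner_integral_sum has_bochner_integral_mult_right)
  moreover have "trace (transpose A ** covariance_matrix M)
      = (\<Sum>i\<in>UNIV. \<Sum>j\<in>UNIV. A $ i $ j * covariance_matrix M $ i $ j)"
    unfolding trace_def matrix_matrix_mult_def transpose_def by (simp, rule sum.swap)
  ultimately show ?thesis
    by (simp add: q distrib_left sum.distrib)
qed

lemma gauss_square_integrable:
  assumes "\<Sigma> \<in> SPD"
  shows "integrable (gauss_measure \<mu> \<Sigma>) (\<lambda>y. (norm y)\<^sup>2)"
proof -
  interpret prob_space "gauss_measure \<mu> \<Sigma>" using assms by (rule gauss_moments)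
  have "integrable (gauss_measure \<mu> \<Sigma>) (\<lambda>y. (y $ i - \<mu> $ i) * (y $ i - \<mu> $ i) + 2 * \<mu> $ i * y $ i - (\<mu> $ i)\<^sup>2)" for i
    using gauss_moments(2,3)[OF assms] by (auto simp: has_bochner_integral_iff)
  then have "integrable (gauss_measure \<mu> \<Sigma>) (\<lambda>y. y $ i * y $ i)" for i
    by (simp add: algebra_simps power2_eq_square)
  then show ?thesis
    by (simp add: power2_norm_eq_inner inner_vec_def)
qed

lemma gauss_mean_covariance:
  assumes "\<Sigma> \<in> SPD"
  shows "mean_vector (gauss_measure \<mu> \<Sigma>) = \<mu>" "covariance_matrix (gauss_measure \<mu> \<Sigma>) = \<Sigma>"
proof -
  note M = gauss_moments(1)[OF assms, of \<mu>] _ gauss_square_integrable[OF assms, of \<mu>]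
  show m: "mean_vector (gauss_measure \<mu> \<Sigma>) = \<mu>"
    using gauss_moments(2)[OF assms, of \<mu>] square_integrable_components(4)[OF M]
    by (simp add: vec_eq_iff has_bochner_integral_iff)
  show "covariance_matrix (gauss_measure \<mu> \<Sigma>) = \<Sigma>"
    using gauss_moments(3)[OF assms, of \<mu>]
    by (simp add: vec_eq_iff covariance_matrix_def m has_bochner_integral_iff)
qed

section \<open>Divergence from a scaled Gaussian\<close>

text \<open>
  The conditions make the divergence from every scaled Gaussian finite and split it into terms that
  are integrable one by one. Since \<open>ln 0 = 0\<close>, the last integrand is 0 where \<open>f\<close> vanishes.
\<close>
definition finite_entropy_density :: "(real^'n \<Rightarrow> real) \<Rightarrow> bool" where
  "finite_entropy_density f \<longleftrightarrow>
     f \<in> borel_measurable borel \<and> (\<forall>y. 0 \<le> f y) \<and> has_bochner_integral lborel f 1 \<and>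
     integrable lborel (\<lambda>y. f y * (norm y)\<^sup>2) \<and> integrable lborel (\<lambda>y. f y * ln (f y))"

text \<open>
  The part of the divergence from \<open>l N(\<mu>, \<Sigma>)\<close> that depends on \<open>(l, \<mu>, \<Sigma>)\<close>, for a measure with mass
  \<open>r\<close> whose normalisation has mean \<open>m\<close> and covariance \<open>S\<close>.
\<close>
definition gauss_objective ::
    "real \<Rightarrow> real^'n \<Rightarrow> real^'n^'n \<Rightarrow> real \<Rightarrow> real^'n \<Rightarrow> real^'n^'n \<Rightarrow> real" where
  "gauss_objective r m S l \<mu> \<Sigma> =
     l + r / 2 * (ln (det \<Sigma>) - 2 * ln l + trace (transpose (matrix_inv \<Sigma>) ** S)
          + (m - \<mu>) \<bullet> (matrix_inv \<Sigma> *v (m - \<mu>)))"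

lemma prob_space_density:
  assumes [measurable]: "f \<in> borel_measurable borel" and nn: "\<And>y. 0 \<le> f y"
  shows "prob_space (density lborel (\<lambda>y::real^'n. ennreal (f y))) \<longleftrightarrow> has_bochner_integral lborel f 1"
proof
  assume "has_bochner_integral lborel f 1"
  then have "(\<integral>\<^sup>+ y. ennreal (f y) \<partial>lborel) = 1"
    using nn by (subst nn_integral_eq_integral) (auto simp: has_bochner_integral_iff)
  then show "prob_space (density lborel (\<lambda>y::real^'n. ennreal (f y)))"
    by (intro prob_spaceI) (simp add: emeasure_density)
next
  assume "prob_space (density lborel (\<lambda>y::real^'n. ennreal (f y)))"
  from prob_space.emeasure_space_1[OF this] have "(\<integral>\<^sup>+ y. ennreal (f y) \<partial>lborel) = ennreal 1"
    by (simp add: emeasure_density)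
  then show "has_bochner_integral lborel f 1"
    using nn by (intro has_bochner_integral_nn_integral) auto
qed

lemma gauss_integral: "\<Sigma> \<in> SPD \<Longrightarrow> has_bochner_integral lborel (gauss_density \<mu> \<Sigma>) 1"
  using gauss_moments(1)[of \<Sigma> \<mu>] prob_space_density[of "gauss_density \<mu> \<Sigma>"]
  by (auto simp: less_imp_le gauss_density_pos)

lemma ln_gauss_density:
  fixes \<mu> y :: "real^'n"
  assumes "\<Sigma> \<in> SPD"
  shows "ln (gauss_density \<mu> \<Sigma> y) = - ((y - \<mu>) \<bullet> (matrix_inv \<Sigma> *v (y - \<mu>))) / 2
     - (real CARD('n) * ln (2 * pi) + ln (det \<Sigma>)) / 2"
  using det_SPD_pos[OF assms]
  by (simp add: gauss_density_def ln_div ln_sqrt ln_mult ln_realpow distrib_left)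

text \<open>
  The logarithm of a Gaussian density is a quadratic polynomial, so finiteness of the entropy is
  finiteness of the second moments.
\<close>
lemma finite_entropy_density_gauss:
  fixes \<mu> :: "real^'n"
  assumes "\<Sigma> \<in> SPD"
  shows "finite_entropy_density (gauss_density \<mu> \<Sigma>)"
proof -
  let ?g = "gauss_density \<mu> \<Sigma>"
  let ?q = "\<lambda>y. (y - \<mu>) \<bullet> (matrix_inv \<Sigma> *v (y - \<mu>))"
  have nn: "0 \<le> ?g y" for y using gauss_density_pos[OF assms] by (rule less_imp_le)
  have dens: "integrable lborel (\<lambda>y. ?g y * h y)"
    if "integrable (gauss_measure \<mu> \<Sigma>) h" "h \<in> borel_measurable borel" for h :: "real^'n \<Rightarrow> real"
    using that nn by (subst (asm) integrable_density) auto
  have sq: "integrable (gauss_measure \<mu> \<Sigma>) (\<lambda>y. (norm y)\<^sup>2)"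
    by (rule gauss_square_integrable[OF assms])
  have q: "integrable (gauss_measure \<mu> \<Sigma>) ?q"
    using quadratic_form_expectation[OF gauss_moments(1)[OF assms] _ sq]
    by (auto simp: has_bochner_integral_iff)
  have "integrable lborel (\<lambda>y. - 1 / 2 * (?g y * ?q y) - (real CARD('n) * ln (2 * pi) + ln (det \<Sigma>)) / 2 * ?g y)"
    using gauss_integral[OF assms, of \<mu>] dens[OF q]
    by (intro Bochner_Integration.integrable_diff integrable_mult_right) (auto simp: has_bochner_integral_iff)
  moreover have "- 1 / 2 * (g * q) - K * g = g * (- q / 2 - K)" for g q K :: real
    by (simp add: algebra_simps)
  ultimately have "integrable lborel (\<lambda>y. ?g y * ln (?g y))"
    by (simp only: ln_gauss_density[OF assms])
  then show ?thesis
    using gauss_integral[OF assms, of \<mu>] dens[OF sq] nn by (simp add: finite_entropy_density_def)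
qed

text \<open>
  For \<open>a > 0\<close> the expression is \<open>a (z - 1 - ln z)\<close> with \<open>z = b / a\<close>, and \<open>ln z \<le> z - 1\<close> with equality
  only at \<open>z = 1\<close>.
\<close>
lemma KL_integrand_nonneg:
  fixes a b :: real
  assumes "a \<ge> 0" "b > 0"
  shows "a * ln (a / b) - a + b \<ge> 0" and "a * ln (a / b) - a + b = 0 \<Longrightarrow> a = b"
proof -
  have "a * ln (a / b) - a + b \<ge> 0 \<and> (a * ln (a / b) - a + b = 0 \<longrightarrow> a = b)"
  proof (cases "a = 0")
    case False
    then have a: "a > 0" using assms by simp
    have *: "a * ln (a / b) - a + b = a * (b / a - 1 - ln (b / a))"
      using a assms by (simp add: ln_div algebra_simps)
    have "ln (b / a) \<le> b / a - 1" using a assms by (intro ln_le_minus_one) simp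
    moreover have "b / a = 1" if "ln (b / a) = b / a - 1"
      using a assms that by (intro ln_eq_minus_one) simp_all
    ultimately show ?thesis
      unfolding * using a by auto
  qed (use assms in auto)
  then show "a * ln (a / b) - a + b \<ge> 0" "a * ln (a / b) - a + b = 0 \<Longrightarrow> a = b" by auto
qed

text \<open>
  By \<open>ln_gauss_density\<close> the integrand is a linear combination of \<open>f\<close>, \<open>f ln f\<close>, \<open>f\<close> times a quadratic
  form, and the Gaussian density itself. The integrals of these are 1, the negative entropy, the value
  from \<open>quadratic_form_expectation\<close>, and 1.
\<close>
theorem KL_gauss:
  fixes f :: "real^'n \<Rightarrow> real"
  assumes f: "finite_entropy_density f" and r: "r > 0"
  defines "M \<equiv> density lborel (\<lambda>y. ennreal (f y))"
  shows "\<exists>c. \<forall>l>0. \<forall>\<mu>. \<forall>\<Sigma>\<in>SPD. KL (\<lambda>y. r * f y) (\<lambda>y. l * gauss_density \<mu> \<Sigma> y)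
     = ereal (gauss_objective r (mean_vector M) (covariance_matrix M) l \<mu> \<Sigma> + c)"
proof (intro exI allI impI ballI)
  fix l :: real and \<mu> :: "real^'n" and \<Sigma> :: "real^'n^'n"
  assume l: "l > 0" and S: "\<Sigma> \<in> SPD"
  let ?g = "gauss_density \<mu> \<Sigma>"
  let ?q = "\<lambda>y. (y - \<mu>) \<bullet> (matrix_inv \<Sigma> *v (y - \<mu>))"
  let ?K = "(real CARD('n) * ln (2 * pi) + ln (det \<Sigma>)) / 2"
  let ?I = "\<lambda>y. r * f y * ln (r * f y / (l * ?g y)) - r * f y + l * ?g y"
  have [measurable]: "f \<in> borel_measurable borel" and nn: "\<And>y. 0 \<le> f y"
    and one: "has_bochner_integral lborel f 1"
    and sq: "integrable lborel (\<lambda>y. f y * (norm y)\<^sup>2)"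
    and ent: "integrable lborel (\<lambda>y. f y * ln (f y))"
    using f by (auto simp: finite_entropy_density_def)
  have pos: "?g y > 0" for y by (rule gauss_density_pos[OF S])
  have M: "prob_space M" "sets M = sets borel" "integrable M (\<lambda>y. (norm y)\<^sup>2)"
    unfolding M_def using one sq nn by (simp_all add: prob_space_density integrable_density)
  define Q where "Q = trace (transpose (matrix_inv \<Sigma>) ** covariance_matrix M)
    + (mean_vector M - \<mu>) \<bullet> (matrix_inv \<Sigma> *v (mean_vector M - \<mu>))"
  have "has_bochner_integral M ?q Q"
    unfolding Q_def by (rule quadratic_form_expectation[OF M])
  then have q: "has_bochner_integral lborel (\<lambda>y. f y * ?q y) Q"
    unfolding M_def using nn by (simp add: has_bochner_integral_iff integrable_density integral_density)
  have I: "?I y = (r * ln r - r * ln l + r * ?K - r) * f y + r * (f y * ln (f y)) + r / 2 * (f y * ?q y) + l * ?g y" for y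
  proof (cases "f y = 0")
    case False
    then have "f y > 0" using nn[of y] by simp
    then have "ln (r * f y / (l * ?g y)) = ln r + ln (f y) - ln l + ?q y / 2 + ?K"
      using r l pos[of y] by (simp add: ln_div ln_mult ln_gauss_density[OF S])
    moreover have "r * f y * (a + b - c + q / 2 + K) - r * f y + e
        = (r * a - r * c + r * K - r) * f y + r * (f y * b) + r / 2 * (f y * q) + e"
      for a b c q K e :: real by (simp add: algebra_simps)
    ultimately show ?thesis by (simp only:)
  qed simp
  have "has_bochner_integral lborel (\<lambda>y. (r * ln r - r * ln l + r * ?K - r) * f y + r * (f y * ln (f y)) + r / 2 * (f y * ?q y) + l * ?g y)
     ((r * ln r - r * ln l + r * ?K - r) * 1 + r * (\<integral>y. f y * ln (f y) \<partial>lborel) + r / 2 * Q + l * 1)"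
    using ent by (intro has_bochner_integral_add has_bochner_integral_mult_right one q gauss_integral[OF S])
      (simp_all add: has_bochner_integral_iff)
  also have "(r * ln r - r * ln l + r * ?K - r) * 1 + r * (\<integral>y. f y * ln (f y) \<partial>lborel) + r / 2 * Q + l * 1
     = gauss_objective r (mean_vector M) (covariance_matrix M) l \<mu> \<Sigma>
       + (r * ln r - r + r * (real CARD('n) * ln (2 * pi) / 2) + r * (\<integral>y. f y * ln (f y) \<partial>lborel))" (is "_ = ?V")
    by (simp add: gauss_objective_def Q_def field_simps)
  finally have hb: "has_bochner_integral lborel ?I ?V"
    unfolding I .
  have Inn: "?I y \<ge> 0" for y
    using KL_integrand_nonneg(1)[of "r * f y" "l * ?g y"] nn[of y] pos[of y] l r by simp
  have "(\<integral>\<^sup>+ y. ennreal (?I y) \<partial>lborel) = ennreal ?V"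
    using hb Inn by (subst nn_integral_eq_integral) (auto simp: has_bochner_integral_iff)
  moreover have "0 \<le> (\<integral>y. ?I y \<partial>lborel)"
    using Inn by (intro integral_nonneg_AE AE_I2)
  then have "?V \<ge> 0"
    by (simp only: has_bochner_integral_integral_eq[OF hb])
  moreover have "AE y in lborel. l * ?g y = 0 \<longrightarrow> r * f y = 0"
    using pos l by (intro AE_I2) (simp add: less_imp_neq[symmetric])
  ultimately show "KL (\<lambda>y. r * f y) (\<lambda>y. l * ?g y) = ereal ?V"
    unfolding KL_def by (simp add: mult.assoc)
qed

lemma KL_nonneg: "KL p q \<ge> 0"
  by (simp add: KL_def)

lemma KL_gauss_self:
  assumes "\<Sigma> \<in> SPD" "r > 0"
  shows "KL (\<lambda>y. r * gauss_density \<mu> \<Sigma> y) (\<lambda>y. r * gauss_density \<mu> \<Sigma> y) = 0"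
proof -
  have "gauss_density \<mu> \<Sigma> y \<noteq> 0" for y using gauss_density_pos[OF assms(1)] by (metis less_irrefl)
  then show ?thesis using assms(2) by (simp add: KL_def zero_ennreal.rep_eq)
qed

text \<open>
  A vanishing integral of the non-negative integrand makes the two densities agree almost everywhere;
  total mass, mean and covariance then determine the parameters.
\<close>
lemma KL_gauss_eq_0:
  assumes S: "S \<in> SPD" "\<Sigma> \<in> SPD" and r: "r > 0" "l > 0"
    and 0: "KL (\<lambda>y. r * gauss_density m S y) (\<lambda>y. l * gauss_density \<mu> \<Sigma> y) = 0"
  shows "l = r \<and> \<mu> = m \<and> \<Sigma> = S"
proof -
  let ?a = "\<lambda>y. r * gauss_density m S y" and ?b = "\<lambda>y. l * gauss_density \<mu> \<Sigma> y"
  have pos: "?a y > 0" "?b y > 0" for y using r S by (auto simp: gauss_density_pos)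
  have ac: "AE y in lborel. ?b y = 0 \<longrightarrow> ?a y = 0"
    using pos(2) by (intro AE_I2) (metis less_irrefl)
  have "(\<integral>\<^sup>+ y. ennreal (?a y * ln (?a y / ?b y) - ?a y + ?b y) \<partial>lborel) = 0"
    using 0 unfolding KL_def if_P[OF ac] by (simp add: zero_ennreal.rep_eq[symmetric] enn2ereal_inject)
  then have "AE y in lborel. ennreal (?a y * ln (?a y / ?b y) - ?a y + ?b y) = 0"
    by (subst (asm) nn_integral_0_iff_AE) auto
  then have ae: "AE y in lborel. ?a y = ?b y"
  proof eventually_elim
    case (elim y)
    then show ?case
      using KL_integrand_nonneg[of "?a y" "?b y"] pos[of y] by (simp add: ennreal_eq_0_iff)
  qed
  then have "(\<integral>y. ?a y \<partial>lborel) = (\<integral>y. ?b y \<partial>lborel)"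
    by (intro integral_cong_AE) auto
  then have lr: "l = r"
    using gauss_integral[OF S(1), of m] gauss_integral[OF S(2), of \<mu>] by (simp add: has_bochner_integral_iff)
  have "gauss_measure m S = gauss_measure \<mu> \<Sigma>"
    using ae r lr by (intro density_cong) auto
  then show ?thesis
    using gauss_mean_covariance[OF S(1), of m] gauss_mean_covariance[OF S(2), of \<mu>] lr by simp
qed

text \<open>
  Since \<open>N(m, S)\<close> itself has mean \<open>m\<close> and covariance \<open>S\<close>, the theorem \<open>KL_gauss\<close> with \<open>f = N(m, S)\<close>
  identifies the objective, up to a constant, with the divergence of \<open>l N(\<mu>, \<Sigma>)\<close> from \<open>r N(m, S)\<close>.
  This divergence is non-negative, and it is 0 for equal parameters and for no others.
\<close>
theorem gauss_objective_minimum: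
  fixes m \<mu> :: "real^'n"
  assumes S: "S \<in> SPD" "\<Sigma> \<in> SPD" and r: "r > 0" "l > 0"
  shows "gauss_objective r m S r m S \<le> gauss_objective r m S l \<mu> \<Sigma>"
    and "gauss_objective r m S l \<mu> \<Sigma> \<le> gauss_objective r m S r m S \<Longrightarrow> l = r \<and> \<mu> = m \<and> \<Sigma> = S"
proof -
  obtain c where c: "KL (\<lambda>y. r * gauss_density m S y) (\<lambda>y. l * gauss_density \<mu> \<Sigma> y)
      = ereal (gauss_objective r m S l \<mu> \<Sigma> + c)" if "l > 0" "\<Sigma> \<in> SPD" for l \<mu> \<Sigma>
    using KL_gauss[OF finite_entropy_density_gauss[OF S(1)] r(1), of m]
    unfolding gauss_mean_covariance[OF S(1)] by blast
  have z: "gauss_objective r m S r m S + c = 0"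
    using c[OF r(1) S(1), of m] KL_gauss_self[OF S(1) r(1), of m] by simp
  have "0 \<le> KL (\<lambda>y. r * gauss_density m S y) (\<lambda>y. l * gauss_density \<mu> \<Sigma> y)"
    by (rule KL_nonneg)
  then have nn: "0 \<le> gauss_objective r m S l \<mu> \<Sigma> + c"
    using c[OF r(2) S(2), of \<mu>] by simp
  then show "gauss_objective r m S r m S \<le> gauss_objective r m S l \<mu> \<Sigma>" using z by simp
  assume "gauss_objective r m S l \<mu> \<Sigma> \<le> gauss_objective r m S r m S"
  then have "gauss_objective r m S l \<mu> \<Sigma> + c = 0" using nn z by simp
  then show "l = r \<and> \<mu> = m \<and> \<Sigma> = S"
    using c[OF r(2) S(2), of \<mu>] by (intro KL_gauss_eq_0[OF S r]) simp
qed

section \<open>Quadratically weighted isotropic Gaussians\<close>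

lemma scaled_mat_1_SPD:
  assumes "s > 0"
  shows "s *\<^sub>R (mat 1 :: real^'n^'n) \<in> SPD"
proof -
  have "transpose (s *\<^sub>R (mat 1 :: real^'n^'n)) = s *\<^sub>R mat 1"
    by (simp add: vec_eq_iff transpose_def mat_def)
  then show ?thesis
    using assms by (simp add: SPD_def pos_definite_def scaleR_matrix_vector_assoc[symmetric])
qed

lemma isotropic_gauss:
  fixes m y :: "real^'n"
  assumes "s > 0"
  shows "gauss_density m (s *\<^sub>R mat 1) y
     = gauss_density m (s *\<^sub>R mat 1) m * exp (- (norm (y - m))\<^sup>2 / (2 * s))"
proof -
  have "matrix_inv (s *\<^sub>R mat 1 :: real^'n^'n) = (1 / s) *\<^sub>R mat 1"
    using assms by (intro matrix_inv_eqI) (simp add: scalar_matrix_assoc[symmetric] matrix_scalar_ac)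
  then show ?thesis
    by (simp add: gauss_density_def scaleR_matrix_vector_assoc[symmetric] power2_norm_eq_inner mult.commute)
qed

text \<open>
  A Gaussian with twice the variance dominates: with \<open>u = (norm (y - m))\<^sup>2 / (4 * s)\<close> the exponential
  factor of the given Gaussian is \<open>exp (-2 u)\<close>, that of the wider one is \<open>exp (-u)\<close>, and
  \<open>(1 + u)\<^sup>2 \<le> 2 exp u\<close>.
\<close>
lemma isotropic_gauss_integrable_quartic:
  fixes m :: "real^'n" and h :: "real^'n \<Rightarrow> real"
  assumes s: "s > 0" and [measurable]: "h \<in> borel_measurable borel"
    and h: "\<And>y. \<bar>h y\<bar> \<le> C * (1 + (norm (y - m))\<^sup>2)\<^sup>2"
  shows "integrable lborel (\<lambda>y. gauss_density m (s *\<^sub>R mat 1) y * h y)"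
proof -
  let ?p = "gauss_density m (s *\<^sub>R mat 1)" and ?g = "gauss_density m ((2 * s) *\<^sub>R mat 1)"
  \<comment> \<open>the constant for which \<open>B * ?g\<close> dominates \<open>?p * h\<close>; \<open>?p m\<close> and \<open>?g m\<close> are the normalising constants\<close>
  define B where "B = C * (2 * (1 + 4 * s)\<^sup>2) * ?p m / ?g m"
  have pos: "?p y > 0" "?g y > 0" for y
    using s by (auto intro!: gauss_density_pos scaled_mat_1_SPD)
  have C: "C \<ge> 0" using h[of m] by simp
  have "integrable lborel (\<lambda>y. B * ?g y)"
    using gauss_integral[OF scaled_mat_1_SPD[of "2 * s"], of m] s
    by (intro integrable_mult_right) (auto simp: has_bochner_integral_iff)
  then show ?thesis
  proof (rule Bochner_Integration.integrable_bound)
    show "AE y in lborel. norm (?p y * h y) \<le> norm (B * ?g y)"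
    proof (rule AE_I2)
      fix y
      define u where "u = (norm (y - m))\<^sup>2 / (4 * s)"
      have u: "u \<ge> 0" "(norm (y - m))\<^sup>2 = 4 * s * u" using s by (auto simp: u_def)
      have "(1 + 4 * s * u)\<^sup>2 \<le> ((1 + 4 * s) * (1 + u))\<^sup>2"
        using s u by (intro power_mono) (auto simp: algebra_simps)
      also have "\<dots> = (1 + 4 * s)\<^sup>2 * (1 + u)\<^sup>2" by (rule power_mult_distrib)
      also have "\<dots> \<le> (1 + 4 * s)\<^sup>2 * (2 * exp u)"
        using exp_lower_Taylor_quadratic[OF u(1)] by (intro mult_left_mono zero_le_power2) (simp add: power2_sum)
      finally have quart: "(1 + 4 * s * u)\<^sup>2 \<le> 2 * (1 + 4 * s)\<^sup>2 * exp u" by (simp add: mult_ac)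
      have py: "?p y = ?p m * exp (- u) * exp (- u)"
        using s isotropic_gauss[OF s, of m y] by (simp add: u_def exp_add[symmetric] field_simps)
      have "norm (?p y * h y) = ?p y * \<bar>h y\<bar>" using pos(1)[of y] by (simp add: abs_mult)
      also have "\<dots> \<le> ?p y * (C * (2 * (1 + 4 * s)\<^sup>2 * exp u))"
        using pos(1)[of y] h[of y] quart C unfolding u(2)
        by (intro mult_left_mono order_trans[OF h[of y, unfolded u(2)]]) auto
      also have "\<dots> = ?p m * (C * (2 * (1 + 4 * s)\<^sup>2)) * exp (- u)"
        unfolding py by (simp add: exp_minus)
      also have "\<dots> = B * (?g m * exp (- u))"
        using pos(2)[of m] by (simp add: B_def)
      also have "?g m * exp (- u) = ?g y"
        using s isotropic_gauss[of "2 * s" m y] by (simp add: u_def)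
      finally show "norm (?p y * h y) \<le> norm (B * ?g y)" by simp
    qed
  qed measurable
qed

text \<open>
  The bound \<open>ln z \<le> z - 1\<close> at \<open>z = u\<close> controls large \<open>u\<close>, and at \<open>z = 1 / u\<close> it controls small \<open>u\<close>.
  It keeps the entropy of a quadratically weighted Gaussian within quartic growth.
\<close>
lemma abs_mult_ln_le:
  fixes u :: real
  assumes "u \<ge> 0"
  shows "\<bar>u * ln u\<bar> \<le> 1 + u\<^sup>2"
proof (cases "u = 0")
  case False
  then have u: "u > 0" using assms by simp
  have "u * ln u \<le> u * (u - 1)"
    using u ln_le_minus_one[OF u] by (intro mult_left_mono) auto
  then have "u * ln u \<le> u\<^sup>2 - u" by (simp add: power2_eq_square right_diff_distrib)
  moreover have "u * ln (inverse u) \<le> u * (inverse u - 1)"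
    using u ln_le_minus_one[of "inverse u"] by (intro mult_left_mono) auto
  then have "- (u * ln u) \<le> 1 - u" using u by (simp add: ln_inverse right_diff_distrib)
  ultimately show ?thesis
    using u zero_le_power2[of u] unfolding abs_le_iff by linarith
qed simp

text \<open>
  Each integrand is a linear combination of terms that are the Gaussian times one of \<open>u\<close>, \<open>u (norm y)\<^sup>2\<close>, \<open>u ln u\<close> and
  \<open>u (norm (y - m))\<^sup>2\<close>, and all of these grow at most like the fourth power of the norm.
\<close>
lemma finite_entropy_density_weighted_gauss:
  fixes m :: "real^'n" and u :: "real^'n \<Rightarrow> real"
  assumes s: "s > 0" and [measurable]: "u \<in> borel_measurable borel"
    and nn: "\<And>y. 0 \<le> u y" and bd: "\<And>y. u y \<le> A * (1 + (norm (y - m))\<^sup>2)"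
    and Z: "(\<integral>y. u y * gauss_density m (s *\<^sub>R mat 1) y \<partial>lborel) > 0" (is "?Z > 0")
  shows "finite_entropy_density (\<lambda>y. u y * gauss_density m (s *\<^sub>R mat 1) y / ?Z)"
proof -
  let ?p = "gauss_density m (s *\<^sub>R mat 1)"
  let ?w = "\<lambda>y. 1 + (norm (y - m))\<^sup>2"
  note int = isotropic_gauss_integrable_quartic[OF s, where m=m]
  have pos: "?p y > 0" for y using s by (intro gauss_density_pos scaled_mat_1_SPD)
  have w1: "?w y \<ge> 1" for y by simp
  have ww: "?w y \<le> (?w y)\<^sup>2" for y using self_le_power[OF w1, of 2 y] by simp
  have "0 \<le> A * ?w m" using nn[of m] bd[of m] by (rule order_trans)
  then have A: "A \<ge> 0" by simp
  have i1: "integrable lborel (\<lambda>y. ?p y * u y)"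
  proof (rule int)
    show "\<bar>u y\<bar> \<le> A * (?w y)\<^sup>2" for y
      using nn[of y] bd[of y] mult_left_mono[OF ww[of y] A] by simp
  qed measurable
  have i2: "integrable lborel (\<lambda>y. ?p y * (u y * (norm y)\<^sup>2))"
  proof (rule int)
    fix y
    have "norm y \<le> norm (y - m) + norm m" using norm_triangle_ineq[of "y - m" m] by simp
    then have "(norm y)\<^sup>2 \<le> (norm (y - m) + norm m)\<^sup>2" by (intro power_mono) auto
    also have "\<dots> \<le> 2 * (norm (y - m))\<^sup>2 + 2 * (norm m)\<^sup>2"
      using zero_le_power2[of "norm (y - m) - norm m"] unfolding power2_sum power2_diff by linarith
    also have "\<dots> \<le> 2 * (1 + (norm m)\<^sup>2) * ?w y" by (simp add: algebra_simps)
    finally have "u y * (norm y)\<^sup>2 \<le> (A * ?w y) * (2 * (1 + (norm m)\<^sup>2) * ?w y)"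
      using nn[of y] bd[of y] by (intro mult_mono) auto
    then show "\<bar>u y * (norm y)\<^sup>2\<bar> \<le> (A * (2 * (1 + (norm m)\<^sup>2))) * (?w y)\<^sup>2"
      using nn[of y] by (simp add: power2_eq_square mult_ac)
  qed measurable
  have i3: "integrable lborel (\<lambda>y. ?p y * (u y * ln (u y)))"
  proof (rule int)
    fix y
    have "(u y)\<^sup>2 \<le> (A * ?w y)\<^sup>2" using nn bd by (intro power_mono)
    moreover have "1 \<le> (?w y)\<^sup>2" using w1 ww order_trans by blast
    ultimately have "1 + (u y)\<^sup>2 \<le> (1 + A\<^sup>2) * (?w y)\<^sup>2"
      unfolding distrib_right power_mult_distrib by linarith
    then show "\<bar>u y * ln (u y)\<bar> \<le> (1 + A\<^sup>2) * (?w y)\<^sup>2"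
      using abs_mult_ln_le[OF nn[of y]] by simp
  qed measurable
  have i4: "integrable lborel (\<lambda>y. ?p y * (u y * (norm (y - m))\<^sup>2))"
  proof (rule int)
    fix y
    have "u y * (norm (y - m))\<^sup>2 \<le> (A * ?w y) * ?w y"
      using nn[of y] bd[of y] by (intro mult_mono) auto
    then show "\<bar>u y * (norm (y - m))\<^sup>2\<bar> \<le> A * (?w y)\<^sup>2"
      using nn[of y] by (simp add: power2_eq_square mult_ac)
  qed measurable
  have ent: "u y * ?p y / ?Z * ln (u y * ?p y / ?Z)
      = (?p y * (u y * ln (u y)) - 1 / (2 * s) * (?p y * (u y * (norm (y - m))\<^sup>2))
         + (ln (?p m) - ln ?Z) * (?p y * u y)) / ?Z" for y
  proof (cases "u y = 0")
    case False
    then have "u y > 0" using nn[of y] by simp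
    moreover have "ln (?p y) = ln (?p m) - (norm (y - m))\<^sup>2 / (2 * s)"
      using isotropic_gauss[OF s, of m y] pos[of m] by (simp add: ln_mult)
    ultimately have "ln (u y * ?p y / ?Z) = ln (u y) + (ln (?p m) - (norm (y - m))\<^sup>2 / (2 * s)) - ln ?Z"
      using pos[of y] Z by (simp add: ln_mult ln_div)
    moreover have "a * b / z * (c + (e - n / (2 * s)) - k)
        = (b * (a * c) - 1 / (2 * s) * (b * (a * n)) + (e - k) * (b * a)) / z"
      for a b c e n k z :: real by (simp add: field_simps)
    ultimately show ?thesis by (simp only:)
  qed simp
  have "has_bochner_integral lborel (\<lambda>y. u y * ?p y / ?Z) 1"
    using i1 Z by (auto simp: has_bochner_integral_iff mult.commute)
  moreover have "integrable lborel (\<lambda>y. u y * ?p y / ?Z * (norm y)\<^sup>2)"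
    using integrable_divide[OF i2, of ?Z] by (simp add: mult_ac)
  moreover have "integrable lborel (\<lambda>y. u y * ?p y / ?Z * ln (u y * ?p y / ?Z))"
    unfolding ent using i1 i3 i4
    by (intro integrable_divide Bochner_Integration.integrable_add Bochner_Integration.integrable_diff
        integrable_mult_right)
  ultimately show ?thesis
    using nn pos Z by (auto simp: finite_entropy_density_def less_imp_le)
qed

text \<open>
  The set where \<open>g\<close> is positive is open and not empty, so it is not a null set.
\<close>
lemma integral_positive_part_pos:
  fixes g p :: "real^'n \<Rightarrow> real"
  assumes g: "continuous_on UNIV g" and p: "\<And>y. p y > 0" and pos: "g y0 > 0"
    and int: "integrable lborel (\<lambda>y. max 0 (g y) * p y)"
  shows "(\<integral>y. max 0 (g y) * p y \<partial>lborel) > 0"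
proof (rule ccontr)
  assume "\<not> ?thesis"
  moreover have nn: "0 \<le> max 0 (g y) * p y" for y using p[of y] by simp
  then have "0 \<le> (\<integral>y. max 0 (g y) * p y \<partial>lborel)" by (intro integral_nonneg_AE AE_I2)
  ultimately have "(\<integral>y. max 0 (g y) * p y \<partial>lborel) = 0" by simp
  then have "AE y in lborel. max 0 (g y) * p y = 0"
    using int nn by (simp add: integral_nonneg_eq_0_iff_AE)
  then have "AE y in lborel. y \<in> {y. g y \<le> 0}"
  proof eventually_elim
    case (elim y)
    then show ?case using p[of y] by (auto simp: max_def split: if_splits)
  qed
  then have "AE y in lebesgue. y \<in> {y. g y \<le> 0}" by (rule AE_completion)
  moreover have "closed {y. g y \<le> 0}" using g by (intro closed_Collect_le) auto
  ultimately have "y0 \<in> {y. g y \<le> 0}" by (intro mem_closed_if_AE_lebesgue)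
  then show False using pos by simp
qed

section \<open>The jump kernel\<close>

text \<open>
  Reflection at the path mean removes the linear term of \<open>\<xi>\<close>.
\<close>
lemma jump_xi_sum_reflected:
  fixes x0 x1 z :: "real^'n" and \<eta> \<rho> t :: real
  defines "m \<equiv> path_mean x0 x1 t" and "\<tau> \<equiv> path_var \<eta> \<rho> t"
  shows "jump_xi \<eta> \<rho> x0 x1 t (m + z) + jump_xi \<eta> \<rho> x0 x1 t (m - z)
    = 2 * (\<eta>\<^sup>2 * (1 - 2 * t) / (2 * \<tau>) * ((norm z)\<^sup>2 / \<tau> - real CARD('n)))"
  by (simp add: jump_xi_def Let_def m_def[symmetric] \<tau>_def[symmetric])

lemma path_var_pos:
  assumes "\<rho> > 0" "t \<in> {0..1}"
  shows "path_var \<eta> \<rho> t > 0"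
  using assms by (auto simp: path_var_def intro!: add_nonneg_pos)

text \<open>
  The quadratic part of \<open>\<xi>\<close> has coefficient \<open>c / \<tau>\<close>. For \<open>c < 0\<close> the function is positive at the path mean,
  for \<open>c = 0\<close> it is odd about the path mean, and for \<open>c > 0\<close> the average over a pair of
  antipodal points of a large sphere about the path mean is positive.
\<close>
lemma jump_xi_pos_exists:
  fixes x0 x1 x :: "real^'n"
  assumes "\<rho> > 0" "t \<in> {0..1}" and neg: "jump_xi \<eta> \<rho> x0 x1 t x < 0"
  shows "\<exists>y. jump_xi \<eta> \<rho> x0 x1 t y > 0"
proof -
  define m where "m = path_mean x0 x1 t"
  define \<tau> where "\<tau> = path_var \<eta> \<rho> t"
  define c where "c = \<eta>\<^sup>2 * (1 - 2 * t) / (2 * \<tau>)"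
  have \<tau>: "\<tau> > 0" using path_var_pos assms by (simp add: \<tau>_def)
  note refl = jump_xi_sum_reflected[of \<eta> \<rho> x0 x1 t, folded m_def \<tau>_def, folded c_def]
  consider "c < 0" | "c = 0" | "c > 0" by linarith
  then show ?thesis
  proof cases
    case 1
    then have "2 * (c * (0 - real CARD('n))) > 0" by (simp add: mult_neg_pos)
    with refl[of 0] have "jump_xi \<eta> \<rho> x0 x1 t m > 0" by simp
    then show ?thesis by blast
  next
    case 2
    with refl[of "x - m"] neg have "jump_xi \<eta> \<rho> x0 x1 t (m - (x - m)) > 0" by simp
    then show ?thesis by blast
  next
    case 3
    \<comment> \<open>any radius whose square exceeds \<open>\<tau> * CARD('n)\<close> would do\<close>
    obtain z :: "real^'n" where z: "norm z = sqrt (2 * \<tau> * real CARD('n))"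
      using vector_choose_size[of "sqrt (2 * \<tau> * real CARD('n))"] \<tau> by auto
    have "(norm z)\<^sup>2 / \<tau> - real CARD('n) = real CARD('n)" using \<tau> by (simp add: z)
    then have "jump_xi \<eta> \<rho> x0 x1 t (m + z) + jump_xi \<eta> \<rho> x0 x1 t (m - z) > 0"
      using refl[of z] 3 by simp
    then have "jump_xi \<eta> \<rho> x0 x1 t (m + z) > 0 \<or> jump_xi \<eta> \<rho> x0 x1 t (m - z) > 0" by linarith
    then show ?thesis by blast
  qed
qed

lemma jump_xi_quadratic_growth:
  fixes x0 x1 :: "real^'n"
  assumes "path_var \<eta> \<rho> t > 0"
  shows "\<exists>A. \<forall>y. max 0 (jump_xi \<eta> \<rho> x0 x1 t y) \<le> A * (1 + (norm (y - path_mean x0 x1 t))\<^sup>2)"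
proof (intro exI allI)
  define m where "m = path_mean x0 x1 t"
  define \<tau> where "\<tau> = path_var \<eta> \<rho> t"
  define c where "c = \<eta>\<^sup>2 * (1 - 2 * t) / (2 * \<tau>)"
  define e where "e = (norm (x1 - x0)) / \<tau>"
  have \<tau>: "\<tau> > 0" using assms by (simp add: \<tau>_def)
  fix y
  define w where "w = norm (y - m)"
  have "c * (w\<^sup>2 / \<tau> - real CARD('n)) \<le> \<bar>c\<bar> * (w\<^sup>2 / \<tau> + real CARD('n))"
  proof -
    have "c * (w\<^sup>2 / \<tau> - real CARD('n)) \<le> \<bar>c\<bar> * \<bar>w\<^sup>2 / \<tau> - real CARD('n)\<bar>"
      by (metis abs_ge_self abs_mult)
    also have "\<dots> \<le> \<bar>c\<bar> * (w\<^sup>2 / \<tau> + real CARD('n))"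
      using \<tau> by (intro mult_left_mono) (auto simp: abs_le_iff)
    finally show ?thesis .
  qed
  moreover have "((x1 - x0) \<bullet> (y - m)) / \<tau> \<le> e * w"
    using \<tau> Cauchy_Schwarz_ineq2[of "x1 - x0" "y - m"] by (simp add: e_def w_def divide_right_mono)
  moreover have "e * w \<le> e * (1 + w\<^sup>2)"
  proof (rule mult_left_mono)
    have "0 \<le> (w - 1)\<^sup>2" by simp
    moreover have "0 \<le> w" by (simp add: w_def)
    ultimately show "w \<le> 1 + w\<^sup>2" by (simp add: power2_diff)
  qed (use \<tau> in \<open>simp add: e_def\<close>)
  moreover have "\<bar>c\<bar> * (w\<^sup>2 / \<tau> + real CARD('n)) \<le> \<bar>c\<bar> * ((1 / \<tau> + real CARD('n)) * (1 + w\<^sup>2))"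
    using \<tau> by (intro mult_left_mono) (auto simp: field_simps)
  ultimately have "jump_xi \<eta> \<rho> x0 x1 t y \<le> (\<bar>c\<bar> * (1 / \<tau> + real CARD('n)) + e) * (1 + w\<^sup>2)"
    unfolding jump_xi_def Let_def m_def[symmetric] \<tau>_def[symmetric] c_def[symmetric] w_def[symmetric]
    by (simp add: algebra_simps)
  moreover have "0 \<le> (\<bar>c\<bar> * (1 / \<tau> + real CARD('n)) + e) * (1 + w\<^sup>2)"
    using \<tau> by (simp add: e_def)
  ultimately show "max 0 (jump_xi \<eta> \<rho> x0 x1 t y)
      \<le> (\<bar>c\<bar> * (1 / \<tau> + real CARD('n)) + e) * (1 + (norm (y - path_mean x0 x1 t))\<^sup>2)"
    by (simp add: w_def m_def)
qed

text \<open>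
  A non-zero rate at \<open>x\<close> means \<open>\<xi> x < 0\<close>. This excludes the degenerate case, where \<open>\<xi>\<close> is identically 0, and
  it makes \<open>\<xi>\<close> positive somewhere, so that the normalising integral is positive.
\<close>
lemma finite_entropy_density_jump:
  fixes x0 x1 x :: "real^'n"
  assumes "\<rho> > 0" "t \<in> {0..1}" and rate: "jump_rate \<eta> \<rho> x0 x1 t x \<noteq> 0"
  shows "finite_entropy_density (jump_density \<eta> \<rho> x0 x1 t)"
proof -
  let ?xi = "jump_xi \<eta> \<rho> x0 x1 t" and ?m = "path_mean x0 x1 t" and ?\<tau> = "path_var \<eta> \<rho> t"
  have \<tau>: "?\<tau> > 0" using assms by (intro path_var_pos)
  have neg: "?xi x < 0" using rate by (auto simp: jump_rate_def max_def split: if_splits)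
  have nd: "\<not> (t = 1/2 \<and> x0 = x1)"
  proof
    assume "t = 1/2 \<and> x0 = x1"
    then have *: "1 - 2 * t = 0" "x1 - x0 = 0" by auto
    from neg show False unfolding jump_xi_def Let_def * by simp
  qed
  obtain y0 where y0: "?xi y0 > 0" using jump_xi_pos_exists[OF assms(1,2) neg] by blast
  obtain A where A: "\<And>y. max 0 (?xi y) \<le> A * (1 + (norm (y - ?m))\<^sup>2)"
    using jump_xi_quadratic_growth[OF \<tau>] by blast
  have cont: "continuous_on UNIV ?xi"
    unfolding jump_xi_def Let_def by (intro continuous_intros)
      (use \<tau> in auto)
  then have [measurable]: "?xi \<in> borel_measurable borel" by (rule borel_measurable_continuous_onI)
  have p: "gauss_density ?m (?\<tau> *\<^sub>R mat 1) y > 0" for y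
    using \<tau> by (intro gauss_density_pos scaled_mat_1_SPD)
  have "integrable lborel (\<lambda>y. gauss_density ?m (?\<tau> *\<^sub>R mat 1) y * max 0 (?xi y))"
  proof (rule isotropic_gauss_integrable_quartic[OF \<tau>])
    fix y
    let ?w = "1 + (norm (y - ?m))\<^sup>2"
    have "0 \<le> A * (1 + (norm (?m - ?m))\<^sup>2)" by (rule order_trans[OF _ A]) simp
    then have "A * ?w \<le> A * ?w\<^sup>2" using self_le_power[of ?w 2] by (intro mult_left_mono) auto
    then show "\<bar>max 0 (?xi y)\<bar> \<le> A * ?w\<^sup>2" using A[of y] by simp
  qed measurable
  then have "(\<integral>y. max 0 (?xi y) * gauss_density ?m (?\<tau> *\<^sub>R mat 1) y \<partial>lborel) > 0"
    by (intro integral_positive_part_pos[OF cont p y0]) (simp add: mult.commute)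
  then have "finite_entropy_density (\<lambda>y. max 0 (?xi y) * gauss_density ?m (?\<tau> *\<^sub>R mat 1) y
      / (\<integral>z. max 0 (?xi z) * gauss_density ?m (?\<tau> *\<^sub>R mat 1) z \<partial>lborel))"
    by (intro finite_entropy_density_weighted_gauss[OF \<tau> _ _ A]) auto
  moreover have "jump_density \<eta> \<rho> x0 x1 t = (\<lambda>y. max 0 (?xi y) * gauss_density ?m (?\<tau> *\<^sub>R mat 1) y
      / (\<integral>z. max 0 (?xi z) * gauss_density ?m (?\<tau> *\<^sub>R mat 1) z \<partial>lborel))"
    unfolding jump_density_def path_density_def if_not_P[OF nd] ..
  ultimately show ?thesis by simp
qed

theorem theorem3p5:
  fixes x0 x1 x :: "real^'n" and \<eta> \<rho> t :: real
  assumes "\<eta> > 0" and "\<rho> > 0" and "t \<in> {0..1}"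
  shows "(\<exists>c::real. \<forall>l>0. \<forall>\<mu>. \<forall>\<Sigma>\<in>SPD.
            KL (\<lambda>y. jump_kernel \<eta> \<rho> x0 x1 t y x) (\<lambda>y. l * gauss_density \<mu> \<Sigma> y)
              = ereal (jump_objective \<eta> \<rho> x0 x1 t x l \<mu> \<Sigma> + c))
       \<and> (jump_rate \<eta> \<rho> x0 x1 t x \<noteq> 0 \<and> pos_definite (jump_cov \<eta> \<rho> x0 x1 t) \<longrightarrow>
            (\<forall>z. is_arg_min (\<lambda>(l, \<mu>, \<Sigma>). jump_objective \<eta> \<rho> x0 x1 t x l \<mu> \<Sigma>)
                   (\<lambda>z. z \<in> {0<..} \<times> UNIV \<times> SPD) z
                 \<longleftrightarrow> z = (jump_rate \<eta> \<rho> x0 x1 t x, jump_mean \<eta> \<rho> x0 x1 t, jump_cov \<eta> \<rho> x0 x1 t)))"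
proof -
  let ?r = "jump_rate \<eta> \<rho> x0 x1 t x" and ?m = "jump_mean \<eta> \<rho> x0 x1 t" and ?S = "jump_cov \<eta> \<rho> x0 x1 t"
  have obj: "jump_objective \<eta> \<rho> x0 x1 t x l \<mu> \<Sigma> = gauss_objective ?r ?m ?S l \<mu> \<Sigma>" for l \<mu> \<Sigma>
    by (simp add: jump_objective_def gauss_objective_def Let_def)
  have "\<exists>c::real. \<forall>l>0. \<forall>\<mu>. \<forall>\<Sigma>\<in>SPD.
            KL (\<lambda>y. jump_kernel \<eta> \<rho> x0 x1 t y x) (\<lambda>y. l * gauss_density \<mu> \<Sigma> y)
              = ereal (jump_objective \<eta> \<rho> x0 x1 t x l \<mu> \<Sigma> + c)"
  proof (cases "?r = 0")
    case True
    have "KL (\<lambda>y. jump_kernel \<eta> \<rho> x0 x1 t y x) (\<lambda>y. l * gauss_density \<mu> \<Sigma> y)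
        = ereal (jump_objective \<eta> \<rho> x0 x1 t x l \<mu> \<Sigma> + 0)" if "l > 0" "\<Sigma> \<in> SPD" for l \<mu> \<Sigma>
    proof -
      have "has_bochner_integral lborel (\<lambda>y. l * gauss_density \<mu> \<Sigma> y) (l * 1)"
        by (intro has_bochner_integral_mult_right gauss_integral that)
      then have "(\<integral>\<^sup>+ y. ennreal (l * gauss_density \<mu> \<Sigma> y) \<partial>lborel) = ennreal l"
        using that by (subst nn_integral_eq_integral)
          (auto simp: has_bochner_integral_iff less_imp_le gauss_density_pos)
      then show ?thesis
        using that by (simp add: KL_def jump_kernel_def True obj gauss_objective_def)
    qed
    then show ?thesis by blast
  next
    case False
    then have r: "?r > 0" by (simp add: jump_rate_def max_def split: if_splits)
    have "(\<lambda>y. jump_kernel \<eta> \<rho> x0 x1 t y x) = (\<lambda>y. ?r * jump_density \<eta> \<rho> x0 x1 t y)"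
      by (simp add: jump_kernel_def)
    then show ?thesis
      using KL_gauss[OF finite_entropy_density_jump[OF assms(2,3) False] r]
      by (simp add: obj jump_mean_def jump_cov_def jump_measure_def)
  qed
  moreover have "is_arg_min (\<lambda>(l, \<mu>, \<Sigma>). jump_objective \<eta> \<rho> x0 x1 t x l \<mu> \<Sigma>)
      (\<lambda>z. z \<in> {0<..} \<times> UNIV \<times> SPD) z \<longleftrightarrow> z = (?r, ?m, ?S)"
    if nz: "?r \<noteq> 0" and pd: "pos_definite ?S" for z
  proof -
    have r: "?r > 0" using nz by (simp add: jump_rate_def max_def split: if_splits)
    have "transpose ?S = ?S"
      by (simp add: jump_cov_def covariance_matrix_def transpose_def mult.commute)
    then have S: "?S \<in> SPD" using pd by (simp add: SPD_def)
    obtain l \<mu> \<Sigma> where z: "z = (l, \<mu>, \<Sigma>)" by (cases z)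
    show ?thesis
    proof
      assume "is_arg_min (\<lambda>(l, \<mu>, \<Sigma>). jump_objective \<eta> \<rho> x0 x1 t x l \<mu> \<Sigma>)
        (\<lambda>z. z \<in> {0<..} \<times> UNIV \<times> SPD) z"
      then have "l > 0" "\<Sigma> \<in> SPD"
        and "\<not> gauss_objective ?r ?m ?S ?r ?m ?S < gauss_objective ?r ?m ?S l \<mu> \<Sigma>"
        using r S by (auto simp: is_arg_min_def z obj)
      then show "z = (?r, ?m, ?S)"
        using gauss_objective_minimum(2)[OF S _ r, of \<Sigma> l ?m \<mu>] by (simp add: z not_less)
    next
      assume "z = (?r, ?m, ?S)"
      then show "is_arg_min (\<lambda>(l, \<mu>, \<Sigma>). jump_objective \<eta> \<rho> x0 x1 t x l \<mu> \<Sigma>)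
        (\<lambda>z. z \<in> {0<..} \<times> UNIV \<times> SPD) z"
        using r S gauss_objective_minimum(1)[OF S _ r]
        by (auto simp: is_arg_min_def obj not_less)
    qed
  qed
  ultimately show ?thesis by blast
qed

end
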